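(* Every solution $\tilde{\mathbf y}(t)=(\dot{\mathbf r}(t),\mathbf L(t),\mathbf{\hat 3}(t))$, $t\ge 0$, of the gliding Lagrange top equations $$m\ddot{\mathbf r}=-\mu g_n\mathbf v_A,\qquad \dot{\mathbf L}=-l\,\mathbf{\hat 3}\times\left(g_n\hat z-\mu g_n\mathbf v_A\right),\qquad \dot{\mathbf{\hat 3}}=\frac1{I_1}\,\mathbf L\times\mathbf{\hat 3}$$ that satisfies $g_n(t)\ge 0$ for all $t\ge 0$ goes asymptotically, as $t\to\infty$, to exactly one of the two vertical spinning solutions $\mathbf y_0$ (upright) and $\mathbf y_\pi$ (upside-down), i.e. the solutions $\mathbf y_{0,\pi}=(\theta=0,\pi;\ \dot\theta=0,\ \dot\varphi=\text{const},\ \omega_3=\text{const},\ \nu_x=0,\ \nu_y=0)$.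
   Context: Gliding Lagrange top (gLT): an axially symmetric rigid body of mass $m>0$ with moments of inertia $I_1=I_2>0$ and $I_3>0$ about the centre of mass $CM$, under gravity $-mg\hat z$ ($g>0$), whose bottom tip $A$ glides in a fixed horizontal plane. Here $\hat z$ is the fixed unit vertical vector, $\mathbf{\hat 3}\in S^2$ is the unit vector along the symmetry axis, the vector from $CM$ to $A$ is $\mathbf a=-l\mathbf{\hat 3}$ with $l>0$, $\boldsymbol\omega$ is the angular velocity, and $\mathbf L=\mathbb I\boldsymbol\omega\in\mathbb R^3$ is the angular momentum about $CM$, so $\boldsymbol\omega=\frac1{I_1}\mathbf L+\left(\frac1{I_3}-\frac1{I_1}\right)(\mathbf L\cdot\mathbf{\hat 3})\mathbf{\hat 3}$. The position of $CM$ is $\mathbf s=(\mathbf r,s_{\hat z})$ with horizontal part $\mathbf r\in\mathbb R^2$; the constraint gives $s_{\hat z}=l\,\mathbf{\hat 3}\cdot\hat z$. The gliding velocity is $\mathbf v_A=\dot{\mathbf s}+\boldsymbol\omega\times\mathbf a=\dot{\mathbf s}-\frac l{I_1}\mathbf L\times\mathbf{\hat 3}$; by the constraint $\mathbf v_A\cdot\hat z=0$, so $\mathbf v_A$ equals $\dot{\mathbf r}$ minus the horizontal part of $\frac{l}{I_1}\mathbf L\times\mathbf{\hat 3}$. The friction coefficient is $\mu>0$, and the vertical reaction force $g_n\hat z$ has $$g_n=\frac{mgI_1^2+ml\left((\mathbf L\cdot\mathbf{\hat 3})(\mathbf L\cdot\hat z)-(\mathbf{\hat 3}\cdot\hat z)|\mathbf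 L|^2\right)}{I_1^2+ml^2I_1\left(1-(\mathbf{\hat 3}\cdot\hat z)^2\right)+ml^2I_1\,\mu\,(\mathbf{\hat 3}\cdot\hat z)(\mathbf v_A\cdot\mathbf{\hat 3})}.$$ The equations are regarded as an autonomous dynamical system $\dot{\mathbf y}=\mathbf Y(\mathbf y)$ for $\mathbf y=(\dot{\mathbf r},\mathbf L,\mathbf{\hat 3})$ in a domain $D\subset\mathbb R^2\times\mathbb R^3\times S^2$, with $\mathbf Y$ a continuous Lipschitz map (so $\mu$ is a function of $\mathbf y$). The quantity $\mathbf L\cdot\mathbf{\hat 3}=I_3\omega_3$ is an integral of motion. Euler angles $(\theta,\varphi,\psi)$: $\theta$ is the angle between $\mathbf{\hat 3}$ and $\hat z$, $\varphi$ is the rotation angle about $\hat z$, $\psi$ is the rotation angle about $\mathbf{\hat 3}$, $\omega_3=\dot\psi+\dot\varphi\cos\theta=\boldsymbol\omega\cdot\mathbf{\hat 3}$, and $\nu_x,\nu_y$ are the components of $\mathbf v_A$ along two orthonormal horizontal axes. In vector form, $\mathbf y_0$ is the solution $\mathbf{\hat 3}=\hat z$, $\mathbf L=I_3\omega_3\hat z$, $\dot{\mathbf r}=0$ and $\mathbf y_\pi$ is the solution $\mathbf{\hat 3}=-\hat z$, $\mathbf L=-I_3\omega_3\hat z$, $\dot{\mathbf r}=0$, where $\omega_3$ is a constant (the conserved value for the solution considered).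
   Formalization: Added assumption: near each boundary point of D not in D, the friction coefficient μ is bounded below by a positive constant; otherwise μ may vanish at the boundary and a solution may never approach a vertical state. Lipschitz is required only on bounded subsets of D. *)

theory Defs
  imports "HOL-Analysis.Analysis"
begin

(* A state is y = (horizontal velocity of CM, L, 3-hat); the third component is a unit vector
   only on phase_space. *)
type_synonym state = "(real^2) \<times> (real^3) \<times> (real^3)"

definition phase_space :: "state set" where
  "phase_space = UNIV \<times> UNIV \<times> sphere 0 1"

definition z_hat :: "real^3" where
  "z_hat = axis 3 1"

definition lift_hor :: "real^2 \<Rightarrow> real^3" where
  "lift_hor u = vector [u $ 1, u $ 2, 0]"

definition hor :: "real^3 \<Rightarrow> real^2" where
  "hor v = vector [v $ 1, v $ 2]"

definition omega :: "real \<Rightarrow> real \<Rightarrow> state \<Rightarrow> real^3" where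
  "omega I1 I3 = (\<lambda>(u, L, n). (1 / I1) *\<^sub>R L + ((1 / I3 - 1 / I1) * (L \<bullet> n)) *\<^sub>R n)"

definition omega3 :: "real \<Rightarrow> real \<Rightarrow> state \<Rightarrow> real" where
  "omega3 I1 I3 = (\<lambda>(u, L, n). omega I1 I3 (u, L, n) \<bullet> n)"

definition n_dot :: "real \<Rightarrow> state \<Rightarrow> real^3" where
  "n_dot I1 = (\<lambda>(u, L, n). (1 / I1) *\<^sub>R cross3 L n)"

(* Velocity of CM; the vertical component is the time derivative of the constraint
   s_z = l (3-hat . z-hat). *)
definition s_dot :: "real \<Rightarrow> real \<Rightarrow> state \<Rightarrow> real^3" where
  "s_dot l I1 = (\<lambda>(u, L, n). lift_hor u + (l * (n_dot I1 (u, L, n) \<bullet> z_hat)) *\<^sub>R z_hat)"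

definition v_A :: "real \<Rightarrow> real \<Rightarrow> state \<Rightarrow> real^3" where
  "v_A l I1 = (\<lambda>(u, L, n). s_dot l I1 (u, L, n) - (l / I1) *\<^sub>R cross3 L n)"

definition g_n_denom :: "real \<Rightarrow> real \<Rightarrow> real \<Rightarrow> (state \<Rightarrow> real) \<Rightarrow> state \<Rightarrow> real" where
  "g_n_denom m l I1 \<mu> = (\<lambda>(u, L, n).
     I1\<^sup>2 + m * l\<^sup>2 * I1 * (1 - (n \<bullet> z_hat)\<^sup>2)
       + m * l\<^sup>2 * I1 * \<mu> (u, L, n) * (n \<bullet> z_hat) * (v_A l I1 (u, L, n) \<bullet> n))"

definition g_n :: "real \<Rightarrow> real \<Rightarrow> real \<Rightarrow> real \<Rightarrow> (state \<Rightarrow> real) \<Rightarrow> state \<Rightarrow> real" where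
  "g_n m g l I1 \<mu> = (\<lambda>(u, L, n).
     (m * g * I1\<^sup>2 + m * l * ((L \<bullet> n) * (L \<bullet> z_hat) - (n \<bullet> z_hat) * (norm L)\<^sup>2))
       / g_n_denom m l I1 \<mu> (u, L, n))"

definition friction :: "real \<Rightarrow> real \<Rightarrow> real \<Rightarrow> real \<Rightarrow> (state \<Rightarrow> real) \<Rightarrow> state \<Rightarrow> real^3" where
  "friction m g l I1 \<mu> y = - (\<mu> y * g_n m g l I1 \<mu> y) *\<^sub>R v_A l I1 y"

definition gLT_field :: "real \<Rightarrow> real \<Rightarrow> real \<Rightarrow> real \<Rightarrow> (state \<Rightarrow> real) \<Rightarrow> state \<Rightarrow> state" where
  "gLT_field m g l I1 \<mu> = (\<lambda>(u, L, n).
     ((1 / m) *\<^sub>R hor (friction m g l I1 \<mu> (u, L, n)),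
      - l *\<^sub>R cross3 n (g_n m g l I1 \<mu> (u, L, n) *\<^sub>R z_hat + friction m g l I1 \<mu> (u, L, n)),
      n_dot I1 (u, L, n)))"

definition gLT_solution ::
  "real \<Rightarrow> real \<Rightarrow> real \<Rightarrow> real \<Rightarrow> (state \<Rightarrow> real) \<Rightarrow> state set \<Rightarrow> (real \<Rightarrow> state) \<Rightarrow> bool" where
  "gLT_solution m g l I1 \<mu> D y \<longleftrightarrow>
     (\<forall>t\<ge>0. y t \<in> D \<and> (y has_vector_derivative gLT_field m g l I1 \<mu> (y t)) (at t within {0..}))"

(* "Continuous Lipschitz" is read as Lipschitz on every bounded part of D: the term L x 3-hat is
   not globally Lipschitz when L is unbounded on D.  The denominator condition says that g_n is
   defined on D (division by 0 being 0 here).  The last clause concerns only boundary points of D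
   that are missing from D: the friction coefficient does not tend to 0 along any sequence in D
   approaching such a point.  It is vacuous for D = phase_space.  Without it a solution in D
   may converge to a non-vertical motion on the boundary of D on which the friction vanishes. *)
definition gLT_domain ::
  "real \<Rightarrow> real \<Rightarrow> real \<Rightarrow> real \<Rightarrow> (state \<Rightarrow> real) \<Rightarrow> state set \<Rightarrow> bool" where
  "gLT_domain m g l I1 \<mu> D \<longleftrightarrow>
     openin (top_of_set phase_space) D \<and> connected D \<and>
     (\<forall>y\<in>D. \<mu> y > 0) \<and>
     (\<forall>y\<in>D. g_n_denom m l I1 \<mu> y \<noteq> 0) \<and>
     (\<forall>B\<subseteq>D. bounded B \<longrightarrow> (\<exists>C. C-lipschitz_on B (gLT_field m g l I1 \<mu>))) \<and>
     (\<forall>p\<in>closure D - D. \<exists>c>0. \<exists>\<epsilon>>0. \<forall>y\<in>D \<inter> ball p \<epsilon>. \<mu> y \<ge> c)"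

(* In the coordinates (velocity of CM, L, 3-hat) the vertical spinning solutions are rest points. *)
definition y_upright :: "real \<Rightarrow> real \<Rightarrow> state" where
  "y_upright I3 w3 = (0, (I3 * w3) *\<^sub>R z_hat, z_hat)"

definition y_upside_down :: "real \<Rightarrow> real \<Rightarrow> state" where
  "y_upside_down I3 w3 = (0, - (I3 * w3) *\<^sub>R z_hat, - z_hat)"

end

theory Submission
  imports Defs "HOL-Complex_Analysis.Great_Picard"
begin

text \<open>The vertical reaction is the value for which the constraint holds, so the energy changes at the
  rate of the power of friction, which is not positive.  Hence the solution is bounded and Lipschitz, and
  by the theorem of Arzela and Ascoli its time shifts have limit motions on \<open>[0, 1]\<close>, on which the
  energy is constant.  There friction vanishes and at each time either the reaction is zero or the tip
  does not slide.  A frictionless motion with these properties is a vertical spinning one: the reaction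
  cannot vanish throughout, and while it does not vanish the absence of sliding makes the horizontal
  part of the axis move uniformly, which contradicts energy conservation unless the axis is at rest.
  So every limit point is one of the two vertical states with the given spin, and by connectedness
  only one of them occurs.\<close>

text \<open>The obstacle is that a limit motion may leave \<open>D\<close>, where no field is given,
  and that \<open>\<mu>\<close> may be unbounded on bounded subsets of \<open>D\<close>, so the
  usual invariance principle for limit sets cannot be applied to the flow on \<open>D\<close>. Two
  devices replace it. First, the friction force is treated as data: \<open>reaction\<close>
  expresses the vertical reaction through the force instead of the coefficient, and this expression
  is continuous on all of \<open>phase_space\<close>. So limits of states and of forces again
  satisfy the equations of motion, inside \<open>D\<close> or not. Second, the force is dominated by
  the sliding velocity, hence its square is dominated by its power. This inequality survives the
  limit, where the power is zero, and makes the limit motion frictionless. Absence of friction does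
  not by itself mean absence of sliding, since the reaction may vanish; this is why the frictionless
  motions need a classification of their own.\<close>

section \<open>Horizontal and vertical parts, and the sliding velocity\<close>

lemma z_hat_nth [simp]: "z_hat $ 1 = 0" "z_hat $ 2 = 0" "z_hat $ 3 = 1"
  by (simp_all add: z_hat_def axis_def)

lemma inner_z_hat: "v \<bullet> z_hat = v $ 3"
  by (simp add: inner_vec_def sum_3)

lemma norm_z_hat: "norm z_hat = 1"
  by (simp add: z_hat_def)

lemma lift_hor_nth [simp]: "lift_hor u $ 1 = u $ 1" "lift_hor u $ 2 = u $ 2" "lift_hor u $ 3 = 0"
  by (simp_all add: lift_hor_def)

lemma hor_nth [simp]: "hor v $ 1 = v $ 1" "hor v $ 2 = v $ 2"
  by (simp_all add: hor_def)

lemma linear_hor: "linear hor"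
  by (rule linearI) (simp_all add: vec_eq_iff forall_2)

lemma linear_lift_hor: "linear lift_hor"
  by (rule linearI) (simp_all add: vec_eq_iff forall_3)

lemmas bounded_linear_hor = linear_conv_bounded_linear[THEN iffD1, OF linear_hor]
lemmas bounded_linear_lift_hor = linear_conv_bounded_linear[THEN iffD1, OF linear_lift_hor]

lemma lift_hor_hor: "v $ 3 = 0 \<Longrightarrow> lift_hor (hor v) = v"
  by (simp add: vec_eq_iff forall_3)

lemma norm_lift_hor [simp]: "norm (lift_hor u) = norm u"
  by (simp add: norm_eq_sqrt_inner inner_vec_def sum_2 sum_3)

lemma bounded_bilinear_cross3: "bounded_bilinear cross3"
  using bilinear_cross bilinear_conv_bounded_bilinear by blast

lemmas tendsto_cross3 [tendsto_intros] = bounded_bilinear.tendsto[OF bounded_bilinear_cross3]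
lemmas tendsto_hor [tendsto_intros] = bounded_linear.tendsto[OF bounded_linear_hor]
lemmas tendsto_lift_hor [tendsto_intros] = bounded_linear.tendsto[OF bounded_linear_lift_hor]

lemma v_A_eq: "v_A l I1 (u, L, n) =
    lift_hor u + (l / I1) *\<^sub>R ((cross3 L n \<bullet> z_hat) *\<^sub>R z_hat - cross3 L n)"
  by (simp add: v_A_def s_dot_def n_dot_def algebra_simps)

lemma v_A_nth_3 [simp]: "v_A l I1 y $ 3 = 0"
  by (cases y) (simp add: v_A_eq inner_z_hat)

lemma tendsto_v_A [tendsto_intros]:
  assumes "(f \<longlongrightarrow> y) F" shows "((\<lambda>x. v_A l I1 (f x)) \<longlongrightarrow> v_A l I1 y) F"
proof -
  have *: "v_A l I1 = (\<lambda>y. lift_hor (fst y) + (l / I1) *\<^sub>R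
     ((cross3 (fst (snd y)) (snd (snd y)) \<bullet> z_hat) *\<^sub>R z_hat - cross3 (fst (snd y)) (snd (snd y))))"
    by (auto simp: fun_eq_iff v_A_eq)
  show ?thesis unfolding * by (intro tendsto_intros assms)
qed

lemma friction_nth_3 [simp]: "friction m g l I1 \<mu> y $ 3 = 0"
  by (simp add: friction_def)

lemma closed_phase_space: "closed phase_space"
  by (simp add: phase_space_def closed_Times)

lemma phase_space_iff [simp]: "(u, L, n) \<in> phase_space \<longleftrightarrow> norm n = 1"
  by (simp add: phase_space_def)

subsection \<open>Motions under a prescribed friction force\<close>

text \<open>Neither the friction law nor \<open>D\<close> is fixed here, because limit motions have
  no friction law. The equations know I3 only through the product of I3 and omega_3, which is the
  component of L along the axis.\<close>

locale gliding_top =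
  fixes m g l I1 :: real
  assumes pos: "m > 0" "g > 0" "l > 0" "I1 > 0"
begin

text \<open>The equation for g_n solved again after \<open>- \<mu> * g_n * v_A\<close> has been
  replaced by a given force f. The friction term moves from the denominator to the numerator, and
  what remains of the denominator is at least \<open>I1\<^sup>2\<close> for a unit vector n.\<close>

definition reaction :: "real^3 \<Rightarrow> state \<Rightarrow> real" where
  "reaction f = (\<lambda>(u, L, n).
     (m * g * I1\<^sup>2 + m * l * ((L \<bullet> n) * (L \<bullet> z_hat) - (n \<bullet> z_hat) * (norm L)\<^sup>2)
        + m * l\<^sup>2 * I1 * (n \<bullet> z_hat) * (f \<bullet> n))
       / (I1\<^sup>2 + m * l\<^sup>2 * I1 * (1 - (n \<bullet> z_hat)\<^sup>2)))"

definition forced_field :: "real^3 \<Rightarrow> state \<Rightarrow> state" where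
  "forced_field f = (\<lambda>(u, L, n).
     ((1 / m) *\<^sub>R hor f, - l *\<^sub>R cross3 n (reaction f (u, L, n) *\<^sub>R z_hat + f), n_dot I1 (u, L, n)))"

lemma reaction_denom_pos:
  assumes "norm n = 1"
  shows "I1\<^sup>2 + m * l\<^sup>2 * I1 * (1 - (n \<bullet> z_hat)\<^sup>2) > 0"
proof -
  have "\<bar>n \<bullet> z_hat\<bar> \<le> 1" using Cauchy_Schwarz_ineq2[of n z_hat] assms norm_z_hat by simp
  then have "(n \<bullet> z_hat)\<^sup>2 \<le> 1" by (simp add: abs_square_le_1)
  then show ?thesis using pos by (intro add_pos_nonneg mult_nonneg_nonneg) auto
qed

lemma g_n_eq_reaction:
  assumes "y \<in> phase_space" "g_n_denom m l I1 \<mu> y \<noteq> 0"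
  shows "g_n m g l I1 \<mu> y = reaction (friction m g l I1 \<mu> y) y"
proof -
  obtain u L n where y: "y = (u, L, n)" by (cases y)
  have D: "I1\<^sup>2 + m * l\<^sup>2 * I1 * (1 - (n \<bullet> z_hat)\<^sup>2) > 0"
    using reaction_denom_pos assms by (simp add: y)
  define G where "G = g_n m g l I1 \<mu> y"
  have "G * g_n_denom m l I1 \<mu> y
      = m * g * I1\<^sup>2 + m * l * ((L \<bullet> n) * (L \<bullet> z_hat) - (n \<bullet> z_hat) * (norm L)\<^sup>2)"
    using assms(2) by (simp add: G_def y g_n_def)
  moreover have "friction m g l I1 \<mu> y \<bullet> n = - (\<mu> y * G * (v_A l I1 y \<bullet> n))"
    by (simp add: friction_def G_def)
  ultimately have "G * (I1\<^sup>2 + m * l\<^sup>2 * I1 * (1 - (n \<bullet> z_hat)\<^sup>2)) =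
      m * g * I1\<^sup>2 + m * l * ((L \<bullet> n) * (L \<bullet> z_hat) - (n \<bullet> z_hat) * (norm L)\<^sup>2)
        + m * l\<^sup>2 * I1 * (n \<bullet> z_hat) * (friction m g l I1 \<mu> y \<bullet> n)"
    by (simp add: g_n_denom_def y algebra_simps)
  then show ?thesis
    using D unfolding G_def[symmetric] by (simp add: reaction_def y field_simps)
qed

lemma gLT_field_eq_forced_field:
  assumes "y \<in> phase_space" "g_n_denom m l I1 \<mu> y \<noteq> 0"
  shows "gLT_field m g l I1 \<mu> y = forced_field (friction m g l I1 \<mu> y) y"
  using g_n_eq_reaction[OF assms] by (cases y) (simp add: gLT_field_def forced_field_def)

text \<open>Friction is the mass times the horizontal acceleration. Bounds and limits of the field
  thus pass to the friction force, although no continuity of \<open>\<mu>\<close> itself is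
  assumed.\<close>

lemma friction_eq_field:
  "friction m g l I1 \<mu> y = lift_hor (m *\<^sub>R fst (gLT_field m g l I1 \<mu> y))"
  using pos by (cases y) (simp add: gLT_field_def lift_hor_hor)

lemma tendsto_reaction [tendsto_intros]:
  assumes "(f \<longlongrightarrow> a) F" "(h \<longlongrightarrow> y) F" "y \<in> phase_space"
  shows "((\<lambda>x. reaction (f x) (h x)) \<longlongrightarrow> reaction a y) F"
proof -
  have [simp]: "I1\<^sup>2 + m * l\<^sup>2 * I1 * (1 - (snd (snd y) \<bullet> z_hat)\<^sup>2) \<noteq> 0"
    using reaction_denom_pos[of "snd (snd y)"] assms(3) by (cases y) simp
  show ?thesis
    unfolding reaction_def case_prod_beta
    by (intro tendsto_intros assms) simp
qed

lemma tendsto_forced_field: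
  assumes "(f \<longlongrightarrow> a) F" "(h \<longlongrightarrow> y) F" "y \<in> phase_space"
  shows "((\<lambda>x. forced_field (f x) (h x)) \<longlongrightarrow> forced_field a y) F"
  unfolding forced_field_def n_dot_def case_prod_beta
  by (intro tendsto_intros assms) (use assms in simp)

text \<open>The total energy without the contribution of the spin $\omega_3$, which is constant.\<close>

definition energy :: "state \<Rightarrow> real" where
  "energy = (\<lambda>(u, L, n). m / 2 * ((norm u)\<^sup>2 + (l / I1 * (cross3 L n \<bullet> z_hat))\<^sup>2)
     + (norm L)\<^sup>2 / (2 * I1) + m * g * l * (n \<bullet> z_hat))"

lemma tendsto_energy [tendsto_intros]:
  assumes "(h \<longlongrightarrow> y) F"
  shows "((\<lambda>x. energy (h x)) \<longlongrightarrow> energy y) F"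
  unfolding energy_def case_prod_beta using pos
  by (intro tendsto_intros assms) auto

text \<open>The force is a function of time, so that the same facts apply to the top itself and to a
  limit of its time shifts, whose states may leave the domain of the friction law.\<close>

definition motion :: "real set \<Rightarrow> (real \<Rightarrow> real^3) \<Rightarrow> (real \<Rightarrow> state) \<Rightarrow> bool" where
  "motion S f y \<longleftrightarrow> (\<forall>t\<in>S. y t \<in> phase_space \<and> f t $ 3 = 0 \<and>
     (y has_vector_derivative forced_field (f t) (y t)) (at t within S))"

lemma motion_subset: "motion S f y \<Longrightarrow> T \<subseteq> S \<Longrightarrow> motion T f y"
  unfolding motion_def by (meson has_vector_derivative_within_subset subsetD)

lemma motion_components:
  assumes "motion S f y"
  obtains u L n where "\<And>t. y t = (u t, L t, n t)"
    "\<And>t. t \<in> S \<Longrightarrow> norm (n t) = 1" "\<And>t. t \<in> S \<Longrightarrow> f t $ 3 = 0"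
    "\<And>t. t \<in> S \<Longrightarrow> (u has_vector_derivative (1 / m) *\<^sub>R hor (f t)) (at t within S)"
    "\<And>t. t \<in> S \<Longrightarrow> (L has_vector_derivative
       - l *\<^sub>R cross3 (n t) (reaction (f t) (y t) *\<^sub>R z_hat + f t)) (at t within S)"
    "\<And>t. t \<in> S \<Longrightarrow> (n has_vector_derivative (1 / I1) *\<^sub>R cross3 (L t) (n t)) (at t within S)"
proof -
  define u L n where "u = (\<lambda>t. fst (y t))" and "L = (\<lambda>t. fst (snd (y t)))"
    and "n = (\<lambda>t. snd (snd (y t)))"
  have y: "y t = (u t, L t, n t)" for t by (simp add: u_def L_def n_def)
  have "(u has_vector_derivative (1 / m) *\<^sub>R hor (f t)) (at t within S)"
    "(L has_vector_derivative
       - l *\<^sub>R cross3 (n t) (reaction (f t) (y t) *\<^sub>R z_hat + f t)) (at t within S)"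
    "(n has_vector_derivative (1 / I1) *\<^sub>R cross3 (L t) (n t)) (at t within S)"
    if "t \<in> S" for t
  proof -
    have d: "(y has_vector_derivative forced_field (f t) (y t)) (at t within S)"
      using assms \<open>t \<in> S\<close> by (simp add: motion_def)
    note d' = bounded_linear.has_vector_derivative[OF bounded_linear_snd d]
    show "(u has_vector_derivative (1 / m) *\<^sub>R hor (f t)) (at t within S)"
      using bounded_linear.has_vector_derivative[OF bounded_linear_fst d]
      by (simp add: u_def[symmetric] y forced_field_def)
    show "(L has_vector_derivative - l *\<^sub>R cross3 (n t) (reaction (f t) (y t) *\<^sub>R z_hat + f t))
       (at t within S)"
      using bounded_linear.has_vector_derivative[OF bounded_linear_fst d']
      by (simp add: L_def[symmetric] y forced_field_def)
    show "(n has_vector_derivative (1 / I1) *\<^sub>R cross3 (L t) (n t)) (at t within S)"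
      using bounded_linear.has_vector_derivative[OF bounded_linear_snd d']
      by (simp add: n_def[symmetric] y forced_field_def n_dot_def)
  qed
  moreover have "norm (n t) = 1" "f t $ 3 = 0" if "t \<in> S" for t
    using assms that y[of t] by (auto simp: motion_def)
  ultimately show ?thesis using that y by blast
qed

text \<open>Newton's equation for the height of the centre of mass. The height is tied to the axis
  by the constraint, so this is a consequence of the equations for L and n: \<open>reaction\<close>
  is exactly the value that makes it true.\<close>

lemma has_real_derivative_vertical_velocity:
  assumes "motion S f y" "t \<in> S"
  shows "((\<lambda>t. l / I1 * (cross3 (fst (snd (y t))) (snd (snd (y t))) \<bullet> z_hat)) has_real_derivative
     reaction (f t) (y t) / m - g) (at t within S)"
proof -
  obtain u L n where y: "\<And>t. y t = (u t, L t, n t)" and n: "norm (n t) = 1" and f: "f t $ 3 = 0"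
    and dL: "(L has_vector_derivative - l *\<^sub>R cross3 (n t) (reaction (f t) (y t) *\<^sub>R z_hat + f t))
       (at t within S)"
    and dn: "(n has_vector_derivative (1 / I1) *\<^sub>R cross3 (L t) (n t)) (at t within S)"
    using motion_components[OF assms(1)] assms(2) by metis
  define R where "R = reaction (f t) (y t)"
  have R: "R * (I1\<^sup>2 + m * l\<^sup>2 * I1 * (1 - (n t \<bullet> z_hat)\<^sup>2)) =
      m * g * I1\<^sup>2 + m * l * ((L t \<bullet> n t) * (L t \<bullet> z_hat) - (n t \<bullet> z_hat) * (norm (L t))\<^sup>2)
        + m * l\<^sup>2 * I1 * (n t \<bullet> z_hat) * (f t \<bullet> n t)"
    using reaction_denom_pos[OF n] by (simp add: R_def y reaction_def)
  have *: "cross3 (L t) ((1 / I1) *\<^sub>R cross3 (L t) (n t)) =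
      (1 / I1) *\<^sub>R ((L t \<bullet> n t) *\<^sub>R L t - (norm (L t))\<^sup>2 *\<^sub>R n t)"
    by (simp add: cross_mult_right Lagrange power2_norm_eq_inner)
  have tri: "cross3 (cross3 (n t) A) (n t) = A - (A \<bullet> n t) *\<^sub>R n t" for A
    using n by (subst cross_skew) (simp add: Lagrange norm_eq_1 inner_commute)
  have **: "cross3 (- l *\<^sub>R cross3 (n t) (R *\<^sub>R z_hat + f t)) (n t) =
      - l *\<^sub>R ((R *\<^sub>R z_hat + f t) - ((R *\<^sub>R z_hat + f t) \<bullet> n t) *\<^sub>R n t)"
    unfolding cross_mult_left tri ..
  have "((\<lambda>t. l / I1 * (cross3 (L t) (n t) \<bullet> z_hat)) has_real_derivative
     l / I1 * ((cross3 (L t) ((1 / I1) *\<^sub>R cross3 (L t) (n t))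
       + cross3 (- l *\<^sub>R cross3 (n t) (R *\<^sub>R z_hat + f t)) (n t)) \<bullet> z_hat)) (at t within S)"
    unfolding has_real_derivative_iff_has_vector_derivative R_def
    by (intro bounded_linear.has_vector_derivative[OF bounded_linear_mult_right]
        bounded_linear.has_vector_derivative[OF bounded_linear_inner_left]
        bounded_bilinear.has_vector_derivative[OF bounded_bilinear_cross3] dL dn)
  moreover have "l / I1 * ((cross3 (L t) ((1 / I1) *\<^sub>R cross3 (L t) (n t))
       + cross3 (- l *\<^sub>R cross3 (n t) (R *\<^sub>R z_hat + f t)) (n t)) \<bullet> z_hat) = R / m - g"
  proof -
    have zz: "z_hat \<bullet> z_hat = 1" "f t \<bullet> z_hat = 0" "z_hat \<bullet> n t = n t \<bullet> z_hat"
      using f by (simp_all add: inner_z_hat) (simp add: inner_commute flip: inner_z_hat)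
    \<comment> \<open>The claim in scalars: A is L . n, B is L . z, C is n . z, N is the square of
      the norm of L and Q is f . n. Multiplying by \<open>m * I1\<^sup>2\<close> clears the
      fractions.\<close>
    have "l / I1 * ((1 / I1) * (A * B - N * C) - l * (R - (R * C + Q) * C)) = R / m - g"
      if "R * (I1\<^sup>2 + m * l\<^sup>2 * I1 * (1 - C\<^sup>2)) =
        m * g * I1\<^sup>2 + m * l * (A * B - C * N) + m * l\<^sup>2 * I1 * C * Q" for A B C N Q
    proof -
      have "m * I1\<^sup>2 * (l / I1 * ((1 / I1) * X - l * Y)) = m * l * X - m * l\<^sup>2 * I1 * Y" for X Y
        using pos by (simp add: field_simps power2_eq_square)
      moreover have "m * I1\<^sup>2 * (R / m - g) = R * I1\<^sup>2 - m * g * I1\<^sup>2"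
        using pos by (simp add: field_simps)
      moreover have "m * l * (A * B - N * C) - m * l\<^sup>2 * I1 * (R - (R * C + Q) * C)
          = R * I1\<^sup>2 - m * g * I1\<^sup>2"
      proof -
        have "m * l * (A * B - N * C) = R * (I1\<^sup>2 + m * l\<^sup>2 * I1 * (1 - C\<^sup>2))
            - m * g * I1\<^sup>2 - m * l\<^sup>2 * I1 * C * Q"
          unfolding that by (simp add: mult.commute[of N C])
        then show ?thesis
          by (simp only:) (simp add: algebra_simps power2_eq_square)
      qed
      ultimately have "m * I1\<^sup>2 * (l / I1 * ((1 / I1) * (A * B - N * C) - l * (R - (R * C + Q) * C)))
          = m * I1\<^sup>2 * (R / m - g)"
        by simp
      then show ?thesis using pos by (simp only: mult_cancel_left) simp
    qed
    from this[OF R] show ?thesis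
      unfolding * ** using pos zz
      by (simp add: inner_add_left inner_diff_left)
  qed
  ultimately show ?thesis by (simp add: y R_def)
qed

text \<open>The work of the reaction on the vertical motion cancels the work of its torque, and the
  weight cancels against the potential energy. Only the power of friction at the tip is
  left.\<close>

lemma energy_has_real_derivative:
  assumes "motion S f y" "t \<in> S"
  shows "((\<lambda>t. energy (y t)) has_real_derivative f t \<bullet> v_A l I1 (y t)) (at t within S)"
proof -
  obtain u L n where y: "\<And>t. y t = (u t, L t, n t)" and f: "f t $ 3 = 0"
    and du: "(u has_vector_derivative (1 / m) *\<^sub>R hor (f t)) (at t within S)"
    and dL: "(L has_vector_derivative - l *\<^sub>R cross3 (n t) (reaction (f t) (y t) *\<^sub>R z_hat + f t))
       (at t within S)"
    and dn: "(n has_vector_derivative (1 / I1) *\<^sub>R cross3 (L t) (n t)) (at t within S)"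
    using motion_components[OF assms(1)] assms(2) by metis
  define R where "R = reaction (f t) (y t)"
  define P where "P = (\<lambda>t. l / I1 * (cross3 (L t) (n t) \<bullet> z_hat))"
  have dP: "(P has_real_derivative R / m - g) (at t within S)"
    using has_real_derivative_vertical_velocity[OF assms] by (simp add: y P_def R_def)
  have duu: "((\<lambda>t. u t \<bullet> u t) has_real_derivative 2 / m * (u t \<bullet> hor (f t))) (at t within S)"
    using bounded_bilinear.has_vector_derivative[OF bounded_bilinear_inner du du]
    by (simp add: has_real_derivative_iff_has_vector_derivative inner_commute)
  have dLL: "((\<lambda>t. L t \<bullet> L t) has_real_derivative
      - 2 * l * (cross3 (L t) (n t) \<bullet> (R *\<^sub>R z_hat + f t))) (at t within S)"
  proof -
    define A where "A = R *\<^sub>R z_hat + f t"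
    have "L t \<bullet> cross3 (n t) A = cross3 (L t) (n t) \<bullet> A"
      by (simp add: cross3_simps)
    then show ?thesis
      using bounded_bilinear.has_vector_derivative[OF bounded_bilinear_inner dL dL]
      by (simp add: has_real_derivative_iff_has_vector_derivative inner_commute
          R_def[symmetric] A_def[symmetric] mult.assoc)
  qed
  have dnz: "((\<lambda>t. n t \<bullet> z_hat) has_real_derivative
      1 / I1 * (cross3 (L t) (n t) \<bullet> z_hat)) (at t within S)"
    using bounded_linear.has_vector_derivative[OF bounded_linear_inner_left dn]
    by (simp add: has_real_derivative_iff_has_vector_derivative)
  have "((\<lambda>t. m / 2 * (u t \<bullet> u t + (P t)\<^sup>2) + (L t \<bullet> L t) / (2 * I1) + m * g * l * (n t \<bullet> z_hat))
      has_real_derivative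
      m / 2 * (2 / m * (u t \<bullet> hor (f t)) + 2 * P t * (R / m - g))
       + (- 2 * l * (cross3 (L t) (n t) \<bullet> (R *\<^sub>R z_hat + f t))) / (2 * I1)
       + m * g * l * (1 / I1 * (cross3 (L t) (n t) \<bullet> z_hat))) (at t within S)"
    using pos by (auto intro!: derivative_eq_intros duu dP dLL dnz simp: field_simps power2_eq_square)
  moreover have "m / 2 * (2 / m * (u t \<bullet> hor (f t)) + 2 * P t * (R / m - g))
       + (- 2 * l * (cross3 (L t) (n t) \<bullet> (R *\<^sub>R z_hat + f t))) / (2 * I1)
       + m * g * l * (1 / I1 * (cross3 (L t) (n t) \<bullet> z_hat)) = f t \<bullet> v_A l I1 (y t)"
  proof -
    have "f t \<bullet> v_A l I1 (y t) = u t \<bullet> hor (f t) - l / I1 * (cross3 (L t) (n t) \<bullet> f t)"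
    proof -
      have "f t \<bullet> z_hat = 0" "f t \<bullet> lift_hor (u t) = u t \<bullet> hor (f t)"
        using f by (simp_all add: inner_vec_def sum_2 sum_3)
      then show ?thesis
        by (simp add: y v_A_eq inner_add_right inner_diff_right inner_commute[of _ "f t"])
    qed
    moreover have "m / 2 * (2 / m * U + 2 * (l / I1 * w) * (R / m - g))
        + (- 2 * l * (R * w + F)) / (2 * I1) + m * g * l * (1 / I1 * w) = U - l / I1 * F" for U F w
      using pos by (simp add: field_simps)
    ultimately show ?thesis
      by (simp add: P_def inner_add_right)
  qed
  ultimately show ?thesis
    by (simp add: y energy_def P_def power2_norm_eq_inner)
qed

text \<open>The product of I3 and omega_3, written without I3.\<close>

definition spin :: "state \<Rightarrow> real" where
  "spin = (\<lambda>(u, L, n). L \<bullet> n)"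

lemma tendsto_spin [tendsto_intros]:
  "(h \<longlongrightarrow> y) F \<Longrightarrow> ((\<lambda>x. spin (h x)) \<longlongrightarrow> spin y) F"
  unfolding spin_def case_prod_beta by (intro tendsto_intros)

text \<open>All forces act at the tip, on the axis, so the torque is orthogonal to n, while the
  derivative of n is orthogonal to L.\<close>

lemma spin_constant:
  assumes "motion S f y" "convex S" "s \<in> S" "t \<in> S"
  shows "spin (y s) = spin (y t)"
proof -
  have "((\<lambda>t. spin (y t)) has_vector_derivative 0) (at t within S)" if ts: "t \<in> S" for t
  proof -
    obtain u L n where y: "\<And>t. y t = (u t, L t, n t)"
      and dL: "(L has_vector_derivative - l *\<^sub>R cross3 (n t) (reaction (f t) (y t) *\<^sub>R z_hat + f t))
         (at t within S)"
      and dn: "(n has_vector_derivative (1 / I1) *\<^sub>R cross3 (L t) (n t)) (at t within S)"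
      using motion_components[OF assms(1)] ts by metis
    show ?thesis
      using bounded_bilinear.has_vector_derivative[OF bounded_bilinear_inner dL dn]
      by (simp add: y spin_def dot_cross_self)
  qed
  then show ?thesis
    using has_vector_derivative_zero_constant[OF assms(2), of "\<lambda>t. spin (y t)"] assms(3,4) by metis
qed

end

text \<open>Covers the one-sided derivatives at the end points, where \<open>a < b\<close> still
  makes the derivative unique.\<close>

lemma has_vector_derivative_constant_on:
  fixes f :: "real \<Rightarrow> 'a::real_normed_vector"
  assumes "a < b" "t \<in> {a..b}" "\<And>s. s \<in> {a..b} \<Longrightarrow> f s = k"
    and "(f has_vector_derivative d) (at t within {a..b})"
  shows "d = 0"
proof -
  have "(f has_vector_derivative 0) (at t within {a..b})"
    by (rule has_vector_derivative_transform[OF assms(2) assms(3) has_vector_derivative_const])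
  then show ?thesis
    using vector_derivative_unique_within_closed_interval[of a b t f d 0] assms by simp
qed

lemma norm_hor: "(norm v)\<^sup>2 = (norm (hor v))\<^sup>2 + (v $ 3)\<^sup>2"
  by (simp add: power2_norm_eq_inner inner_vec_def sum_2 sum_3) (simp add: power2_eq_square)

lemma inner_hor: "v \<bullet> w = hor v \<bullet> hor w + v $ 3 * w $ 3"
  by (simp add: inner_vec_def sum_2 sum_3)

subsection \<open>Frictionless motions\<close>

text \<open>The leading coefficient is enough for the use below: there q2 is minus the squared speed
  of the horizontal part of the axis, and q1 vanishes with that speed.\<close>

lemma poly_identity_degree:
  fixes q0 q1 q2 e \<kappa> \<gamma> :: real
  assumes "infinite S" "\<gamma> \<noteq> 0"
    and eq: "\<And>s. s \<in> S \<Longrightarrow>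
      \<gamma> * (q0 + q1 * s + q2 * s\<^sup>2)^3 = (e * (q0 + q1 * s + q2 * s\<^sup>2) - \<kappa> * (q1 + 2 * q2 * s)\<^sup>2)\<^sup>2"
  shows "q2 = 0"
proof -
  define Q where "Q = [:q0, q1, q2:]"
  define T where "T = smult e Q - smult \<kappa> ([:q1, 2 * q2:] * [:q1, 2 * q2:])"
  define P where "P = smult \<gamma> (Q ^ 3) - T\<^sup>2"
  have Q: "poly Q s = q0 + q1 * s + q2 * s\<^sup>2" for s
    by (simp add: Q_def power2_eq_square algebra_simps)
  have T: "poly T s = e * (q0 + q1 * s + q2 * s\<^sup>2) - \<kappa> * (q1 + 2 * q2 * s)\<^sup>2" for s
    by (simp add: T_def Q power2_eq_square algebra_simps)
  have "poly P s = 0" if "s \<in> S" for s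
    using eq[OF that] by (simp add: P_def Q T)
  then have "S \<subseteq> {s. poly P s = 0}" by blast
  then have P0: "P = 0" using poly_roots_finite[of P] assms(1) finite_subset by blast
  show ?thesis
  proof (rule ccontr)
    assume "q2 \<noteq> 0"
    then have "degree (smult \<gamma> (Q ^ 3)) = 6"
      using assms(2) by (simp add: Q_def degree_power_eq)
    moreover have "degree T \<le> 2"
      unfolding T_def by (intro degree_diff_le order.trans[OF degree_smult_le] order.trans[OF degree_mult_le])
        (simp_all add: Q_def)
    then have "degree (T\<^sup>2) \<le> 4"
      using degree_power_le[of T 2] by simp
    ultimately show False using P0 by (simp add: P_def del: degree_smult_eq)
  qed
qed

text \<open>With 1 in the place of I3, the number \<open>c\<close> stands for the product of I3 and
  omega_3, that is, for the value of \<open>spin\<close>.\<close>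

definition rest_states :: "real \<Rightarrow> state set" where
  "rest_states c = {y_upright 1 c, y_upside_down 1 c}"

context gliding_top
begin

text \<open>Without sliding and friction the horizontal part of the symmetry axis moves uniformly,
  so the square of the vertical component \<open>z\<close> of the axis is a quadratic polynomial \<open>q\<close> in time.
  Energy conservation \<open>K/2 z'\<^sup>2 + mgl z = e\<close> times \<open>z\<^sup>2\<close> then gives an identity between a polynomial
  of degree 6 and one of degree 4 unless \<open>q\<close> is constant.\<close>

lemma nonsliding_motion_at_rest:
  assumes mot: "motion {a..b} (\<lambda>_. 0) y" and "a < b" "t0 \<in> {a..b}"
    and vA: "\<And>s. s \<in> {a..b} \<Longrightarrow> v_A l I1 (y s) = 0"
    and R: "reaction 0 (y t0) \<noteq> 0"
  shows "y t0 \<in> rest_states (spin (y t0))"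
proof -
  obtain u L n where y: "\<And>t. y t = (u t, L t, n t)"
    and n1: "\<And>t. t \<in> {a..b} \<Longrightarrow> norm (n t) = 1"
    and du: "\<And>t. t \<in> {a..b} \<Longrightarrow> (u has_vector_derivative (1 / m) *\<^sub>R hor 0) (at t within {a..b})"
    and dL: "\<And>t. t \<in> {a..b} \<Longrightarrow> (L has_vector_derivative
       - l *\<^sub>R cross3 (n t) (reaction 0 (y t) *\<^sub>R z_hat + 0)) (at t within {a..b})"
    and dn: "\<And>t. t \<in> {a..b} \<Longrightarrow>
       (n has_vector_derivative (1 / I1) *\<^sub>R cross3 (L t) (n t)) (at t within {a..b})"
    using motion_components[OF mot] by metis
  have hor0: "hor 0 = 0" by (simp add: vec_eq_iff forall_2)
  define U where "U = u a"
  have u: "u s = U" if "s \<in> {a..b}" for s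
    using has_vector_derivative_zero_constant[of "{a..b}" u] du that \<open>a < b\<close>
    by (fastforce simp: U_def hor0)
  define p where "p s = 1 / I1 * (cross3 (L s) (n s) $ 3)" for s
  \<comment> \<open>The constant velocity of the horizontal part of the axis: without sliding, U is
    l times this velocity.\<close>
  define \<beta> where "\<beta> = (1 / l) *\<^sub>R U"
  have hn': "hor ((1 / I1) *\<^sub>R cross3 (L s) (n s)) = \<beta>" if "s \<in> {a..b}" for s
  proof -
    have "lift_hor U + (l / I1) *\<^sub>R (cross3 (L s) (n s) $ 3 *\<^sub>R z_hat - cross3 (L s) (n s)) = 0"
      using vA[OF that] u[OF that] by (simp add: y v_A_eq inner_z_hat)
    then show ?thesis
      using pos by (simp add: \<beta>_def vec_eq_iff forall_2 forall_3 field_simps)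
  qed
  have hn: "hor (n s) = hor (n a) + (s - a) *\<^sub>R \<beta>" if "s \<in> {a..b}" for s
  proof -
    have D: "((\<lambda>s. hor (n s) - (s - a) *\<^sub>R \<beta>) has_vector_derivative 0) (at r within {a..b})"
      if "r \<in> {a..b}" for r
    proof -
      have "((\<lambda>s. hor (n s)) has_vector_derivative \<beta>) (at r within {a..b})"
        using bounded_linear.has_vector_derivative[OF bounded_linear_hor dn[OF that]]
        by (simp only: hn'[OF that])
      moreover have "((\<lambda>s. (s - a) *\<^sub>R \<beta>) has_vector_derivative \<beta>) (at r within {a..b})"
        by (auto intro!: derivative_eq_intros)
      ultimately show ?thesis
        using has_vector_derivative_diff by fastforce
    qed
    obtain k where "\<And>s. s \<in> {a..b} \<Longrightarrow> hor (n s) - (s - a) *\<^sub>R \<beta> = k"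
      using has_vector_derivative_zero_constant[OF convex_real_interval(5) D] by blast
    from this[OF that] this[of a] show ?thesis using \<open>a < b\<close> by (simp add: algebra_simps)
  qed
  have orth: "n s $ 3 * p s = - (hor (n s) \<bullet> \<beta>)" if "s \<in> {a..b}" for s
  proof -
    have "n s \<bullet> ((1 / I1) *\<^sub>R cross3 (L s) (n s)) = 0"
      by (simp add: dot_cross_self)
    then show ?thesis
      unfolding inner_hor hn'[OF that] by (simp add: p_def)
  qed
  define q0 q1 q2 where "q0 = 1 - (norm (hor (n a)))\<^sup>2" and "q1 = - 2 * (hor (n a) \<bullet> \<beta>)"
    and "q2 = - (norm \<beta>)\<^sup>2"
  have q: "(n s $ 3)\<^sup>2 = q0 + q1 * (s - a) + q2 * (s - a)\<^sup>2" if "s \<in> {a..b}" for s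
  proof -
    have "(n s $ 3)\<^sup>2 = 1 - (norm (hor (n s)))\<^sup>2"
      using norm_hor[of "n s"] n1[OF that] by simp
    then show ?thesis
      unfolding hn[OF that] q0_def q1_def q2_def power2_norm_eq_inner
      by (simp add: inner_add_left inner_add_right inner_commute power2_eq_square algebra_simps)
  qed
  have q': "2 * (n s $ 3 * p s) = q1 + 2 * q2 * (s - a)" if "s \<in> {a..b}" for s
    unfolding orth[OF that] hn[OF that] q1_def q2_def power2_norm_eq_inner
    by (simp add: inner_add_left algebra_simps)
  define c E where "c = spin (y a)" and "E = energy (y a)"
  have c: "L s \<bullet> n s = c" if "s \<in> {a..b}" for s
    using spin_constant[OF mot, of s a] that by (simp add: c_def spin_def y)
  have E: "energy (y s) = E" if "s \<in> {a..b}" for s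
  proof -
    have "((\<lambda>t. energy (y t)) has_real_derivative 0) (at r within {a..b})" if "r \<in> {a..b}" for r
      using energy_has_real_derivative[OF mot that] by simp
    then show ?thesis
      using has_field_derivative_zero_constant[of "{a..b}" "\<lambda>t. energy (y t)"] that \<open>a < b\<close>
      by (fastforce simp: E_def)
  qed
  have L: "L s = c *\<^sub>R n s + cross3 (n s) (cross3 (L s) (n s))" if "s \<in> {a..b}" for s
    using c[OF that] n1[OF that] by (simp add: Lagrange norm_eq_1 inner_commute)
  \<comment> \<open>The horizontal velocities and the spin are constant, so their energies are
    collected in \<open>e\<close>. The vertical velocity p of the axis contributes through the
    centre of mass, with factor \<open>m * l\<^sup>2\<close>, and through the rotation, with factor
    \<open>I1\<close>.\<close>
  define K e where "K = m * l\<^sup>2 + I1"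
    and "e = E - m / 2 * (norm U)\<^sup>2 - c\<^sup>2 / (2 * I1) - I1 / 2 * (norm \<beta>)\<^sup>2"
  have e: "K / 2 * (p s)\<^sup>2 + m * g * l * (n s $ 3) = e" if "s \<in> {a..b}" for s
  proof -
    have "(norm (cross3 (L s) (n s)))\<^sup>2 = (norm (L s))\<^sup>2 - c\<^sup>2"
      using norm_cross[of "L s" "n s"] n1[OF that] c[OF that] by simp
    moreover have "(norm ((1 / I1) *\<^sub>R cross3 (L s) (n s)))\<^sup>2 = (norm \<beta>)\<^sup>2 + (p s)\<^sup>2"
      unfolding norm_hor[of "_ *\<^sub>R _"] hn'[OF that] by (simp add: p_def)
    ultimately have "(norm (L s))\<^sup>2 = c\<^sup>2 + I1\<^sup>2 * ((norm \<beta>)\<^sup>2 + (p s)\<^sup>2)"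
      using pos by (simp add: field_simps power_divide)
    moreover have "m / 2 * ((norm U)\<^sup>2 + (l * p s)\<^sup>2) + (norm (L s))\<^sup>2 / (2 * I1) + m * g * l * (n s $ 3) = E"
      using E[OF that] u[OF that] by (simp add: energy_def y p_def inner_z_hat)
    ultimately show ?thesis
      using pos by (simp add: e_def K_def field_simps power2_eq_square)
  qed
  have "q2 = 0"
  proof (rule poly_identity_degree)
    show "infinite {0..b - a}" using \<open>a < b\<close> by simp
    show "(m * g * l)\<^sup>2 \<noteq> 0" using pos by simp
    fix r assume "r \<in> {0..b - a}"
    then have s: "r + a \<in> {a..b}" by simp
    define z P where "z = n (r + a) $ 3" and "P = p (r + a)"
    have 1: "z\<^sup>2 = q0 + q1 * r + q2 * r\<^sup>2" and 2: "2 * (z * P) = q1 + 2 * q2 * r"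
      and 3: "K / 2 * P\<^sup>2 + m * g * l * z = e"
      using q[OF s] q'[OF s] e[OF s] by (simp_all add: z_def P_def)
    \<comment> \<open>The factor 1/8 comes from writing z P as half the derivative of q. Since z is
      only a square root of q, the identity must be squared before both sides are
      polynomials.\<close>
    have "m * g * l * z * z\<^sup>2 = e * z\<^sup>2 - K / 8 * (2 * (z * P))\<^sup>2"
      unfolding 3[symmetric] by (simp add: field_simps power2_eq_square)
    then have "(m * g * l * z * z\<^sup>2)\<^sup>2 = (e * z\<^sup>2 - K / 8 * (2 * (z * P))\<^sup>2)\<^sup>2" by simp
    moreover have "(m * g * l * z * z\<^sup>2)\<^sup>2 = (m * g * l)\<^sup>2 * (z\<^sup>2) ^ 3"
      by (simp add: power2_eq_square power3_eq_cube)
    ultimately show "(m * g * l)\<^sup>2 * (q0 + q1 * r + q2 * r\<^sup>2) ^ 3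
        = (e * (q0 + q1 * r + q2 * r\<^sup>2) - K / 8 * (q1 + 2 * q2 * r)\<^sup>2)\<^sup>2"
      unfolding 1 2 by simp
  qed
  then have \<beta>0: "\<beta> = 0" by (simp add: q2_def)
  then have U0: "U = 0" using pos by (simp add: \<beta>_def)
  have q1: "q1 = 0" using \<beta>0 by (simp add: q1_def)
  \<comment> \<open>Now z squared is the constant q0. If it is zero, then z vanishes identically and
    so does its derivative p; otherwise orthogonality of n and its derivative gives z p = 0 with z
    nonzero.\<close>
  have p0: "p s = 0" if s: "s \<in> {a..b}" for s
  proof (cases "q0 = 0")
    case True
    then have "n r $ 3 = 0" if "r \<in> {a..b}" for r
      using q[OF that] q1 \<open>q2 = 0\<close> by simp
    moreover have "((\<lambda>r. n r $ 3) has_vector_derivative p s) (at s within {a..b})"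
      using bounded_linear.has_vector_derivative[OF bounded_linear_vec_nth dn[OF s], of 3] by (simp add: p_def)
    ultimately show ?thesis
      using has_vector_derivative_constant_on[OF \<open>a < b\<close> s, of "\<lambda>r. n r $ 3"] by blast
  next
    case False
    then show ?thesis using q[OF s] orth[OF s] q1 \<open>q2 = 0\<close> \<beta>0 by auto
  qed
  have cross0: "cross3 (L s) (n s) = 0" if s: "s \<in> {a..b}" for s
    using hn'[OF s] p0[OF s] \<beta>0 pos by (simp add: p_def vec_eq_iff forall_2 forall_3)
  have Ln: "L s = c *\<^sub>R n s" if "s \<in> {a..b}" for s
    using L[OF that] cross0[OF that] by simp
  obtain k where k: "\<And>s. s \<in> {a..b} \<Longrightarrow> n s = k"
    using has_vector_derivative_zero_constant[OF convex_real_interval(5), of a b n] dn cross0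
    by (metis scaleR_zero_right)
  \<comment> \<open>With the axis at rest L is constant, so the torque of the reaction vanishes. As
    the reaction at \<open>t0\<close> is nonzero, the axis must be vertical.\<close>
  have "L s = c *\<^sub>R k" if "s \<in> {a..b}" for s using Ln[OF that] k[OF that] by simp
  from has_vector_derivative_constant_on[OF \<open>a < b\<close> \<open>t0 \<in> {a..b}\<close> this dL[OF \<open>t0 \<in> {a..b}\<close>]]
  have "(l * reaction 0 (y t0)) *\<^sub>R cross3 (n t0) z_hat = 0" by (simp add: cross_mult_right)
  then have "cross3 (n t0) z_hat = 0" using R pos by simp
  then have "n t0 $ 1 = 0" "n t0 $ 2 = 0"
    by (simp_all add: cross3_simps forall_3)
  moreover from this have "n t0 $ 3 = 1 \<or> n t0 $ 3 = -1"
    using n1[OF \<open>t0 \<in> {a..b}\<close>] by (simp add: norm_eq_1 inner_vec_def sum_3 power2_eq_1_iff flip: power2_eq_square)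
  ultimately have "n t0 = z_hat \<or> n t0 = - z_hat"
    by (auto simp: vec_eq_iff forall_3)
  moreover have "u t0 = 0" "L t0 = c *\<^sub>R n t0" "spin (y t0) = c"
    using u U0 Ln c \<open>t0 \<in> {a..b}\<close> by (simp_all add: y spin_def)
  ultimately show ?thesis
    by (auto simp: rest_states_def y_upright_def y_upside_down_def y)
qed

text \<open>Without forces at the tip L is constant. Then the vanishing numerator of the reaction
  fixes the height of the centre of mass, whereas free fall demands the acceleration - g.\<close>

lemma reaction_not_identically_zero:
  assumes mot: "motion {a..b} (\<lambda>_. 0) y" and "a < b"
  shows "\<exists>t\<in>{a..b}. reaction 0 (y t) \<noteq> 0"
proof (rule ccontr)
  assume "\<not> ?thesis"
  then have R: "reaction 0 (y t) = 0" if "t \<in> {a..b}" for t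
    using that by blast
  obtain u L n where y: "\<And>t. y t = (u t, L t, n t)"
    and n1: "\<And>t. t \<in> {a..b} \<Longrightarrow> norm (n t) = 1"
    and dL: "\<And>t. t \<in> {a..b} \<Longrightarrow> (L has_vector_derivative
       - l *\<^sub>R cross3 (n t) (reaction 0 (y t) *\<^sub>R z_hat + 0)) (at t within {a..b})"
    and dn: "\<And>t. t \<in> {a..b} \<Longrightarrow>
       (n has_vector_derivative (1 / I1) *\<^sub>R cross3 (L t) (n t)) (at t within {a..b})"
    using motion_components[OF mot] by metis
  have a: "a \<in> {a..b}" using \<open>a < b\<close> by simp
  have "(L has_vector_derivative 0) (at t within {a..b})" if "t \<in> {a..b}" for t
    using dL[OF that] R[OF that] by simp
  then obtain k where k: "\<And>t. t \<in> {a..b} \<Longrightarrow> L t = k"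
    using has_vector_derivative_zero_constant[OF convex_real_interval(5), of a b L] by blast
  define c where "c = spin (y a)"
  have c: "k \<bullet> n t = c" if "t \<in> {a..b}" for t
    using spin_constant[OF mot _ that a] k[OF that] by (simp add: c_def spin_def y)
  have num: "m * g * I1\<^sup>2 + m * l * (c * (k \<bullet> z_hat) - (n t \<bullet> z_hat) * (norm k)\<^sup>2) = 0"
    if "t \<in> {a..b}" for t
    using R[OF that] reaction_denom_pos[OF n1[OF that]] k[OF that] c[OF that]
    by (simp add: y reaction_def)
  \<comment> \<open>For L = 0 the numerator would be \<open>m * g * I1\<^sup>2\<close>; this allows
    solving for n . z next.\<close>
  have k0: "norm k \<noteq> 0"
  proof
    assume "norm k = 0"
    with num[OF a] pos show False by simp
  qed
  have "n t \<bullet> z_hat = (m * g * I1\<^sup>2 + m * l * (c * (k \<bullet> z_hat))) / (m * l * (norm k)\<^sup>2)" if "t \<in> {a..b}" for t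
    using num[OF that] k0 pos by (simp add: field_simps)
  moreover have "((\<lambda>t. n t \<bullet> z_hat) has_vector_derivative ((1 / I1) *\<^sub>R cross3 (L t) (n t)) \<bullet> z_hat)
      (at t within {a..b})" if "t \<in> {a..b}" for t
    by (rule bounded_linear.has_vector_derivative[OF bounded_linear_inner_left dn[OF that]])
  ultimately have "((1 / I1) *\<^sub>R cross3 (L t) (n t)) \<bullet> z_hat = 0" if "t \<in> {a..b}" for t
    using has_vector_derivative_constant_on[OF \<open>a < b\<close> that, of "\<lambda>t. n t \<bullet> z_hat"] that by blast
  then have "l / I1 * (cross3 (fst (snd (y t))) (snd (snd (y t))) \<bullet> z_hat) = 0" if "t \<in> {a..b}" for t
    using that pos by (simp add: y)
  moreover have "((\<lambda>t. l / I1 * (cross3 (fst (snd (y t))) (snd (snd (y t))) \<bullet> z_hat))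
      has_vector_derivative - g) (at a within {a..b})"
    using has_real_derivative_vertical_velocity[OF mot a] R[OF a]
    by (simp add: has_real_derivative_iff_has_vector_derivative)
  ultimately have "- g = 0"
    by (rule has_vector_derivative_constant_on[OF \<open>a < b\<close> a])
  with pos show False by simp
qed

lemma reaction_rest_state: "y \<in> rest_states c \<Longrightarrow> reaction 0 y = m * g"
  using pos
  by (auto simp: rest_states_def y_upright_def y_upside_down_def reaction_def norm_z_hat
      inner_z_hat power2_eq_square)

text \<open>Around a time with nonzero reaction there is no sliding, so the state is vertical and
  the reaction there equals the weight. Being continuous, the reaction cannot jump between 0 and the
  weight.\<close>

lemma frictionless_motion_at_rest:
  assumes mot: "motion {a..b} (\<lambda>_. 0) y" and "a < b" and "t \<in> {a..b}"
    and slide: "\<And>t. t \<in> {a..b} \<Longrightarrow> reaction 0 (y t) = 0 \<or> v_A l I1 (y t) = 0"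
  shows "y t \<in> rest_states (spin (y t))"
proof -
  define R where "R t = reaction 0 (y t)" for t
  have ph: "y t \<in> phase_space" if "t \<in> {a..b}" for t
    using mot that by (simp add: motion_def)
  have "continuous_on {a..b} y"
    using mot unfolding motion_def
    by (meson continuous_on_vector_derivative)
  then have cont: "continuous_on {a..b} R"
    unfolding R_def continuous_on_def using ph by (intro ballI tendsto_reaction) auto
  have rest: "y t \<in> rest_states (spin (y t))" if t: "t \<in> {a..b}" and "R t \<noteq> 0" for t
  proof -
    obtain d where "d > 0" and d: "\<And>s. s \<in> {a..b} \<Longrightarrow> dist s t < d \<Longrightarrow> R s \<noteq> 0"
      using continuous_on_avoid[OF cont t \<open>R t \<noteq> 0\<close>] by (metis dist_commute)
    \<comment> \<open>Half of \<open>d\<close> keeps the closed interval inside the neighbourhood;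
      it stays nondegenerate even if t is an end point of the given interval.\<close>
    define a' b' where "a' = max a (t - d / 2)" and "b' = min b (t + d / 2)"
    have ab: "a' < b'" "t \<in> {a'..b'}" "{a'..b'} \<subseteq> {a..b}"
      using t \<open>d > 0\<close> \<open>a < b\<close> by (auto simp: a'_def b'_def)
    have "R s \<noteq> 0" if "s \<in> {a'..b'}" for s
    proof (rule d)
      show "s \<in> {a..b}" using that ab(3) by blast
      show "dist s t < d" using that \<open>d > 0\<close>
        by (auto simp: a'_def b'_def dist_real_def abs_less_iff)
    qed
    then have "v_A l I1 (y s) = 0" if "s \<in> {a'..b'}" for s
      using slide[of s] that ab(3) by (auto simp: R_def)
    then show ?thesis
      using nonsliding_motion_at_rest[OF motion_subset[OF mot ab(3)] ab(1,2)] \<open>R t \<noteq> 0\<close>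
      by (simp add: R_def)
  qed
  have R_mg: "R t = m * g" if "t \<in> {a..b}" "R t \<noteq> 0" for t
    using rest[OF that] reaction_rest_state by (simp add: R_def)
  have "R t \<noteq> 0"
  proof
    assume "R t = 0"
    obtain t1 where t1: "t1 \<in> {a..b}" "R t1 \<noteq> 0"
      using reaction_not_identically_zero[OF mot \<open>a < b\<close>] by (auto simp: R_def)
    have "connected (R ` {a..b})"
      by (rule connected_continuous_image[OF cont]) simp
    moreover have "0 \<in> R ` {a..b}" "m * g \<in> R ` {a..b}"
      using \<open>R t = 0\<close> \<open>t \<in> {a..b}\<close> t1 R_mg[OF t1] by (metis imageI)+
    moreover have "0 \<le> m * g / 2" "m * g / 2 \<le> m * g" using pos by auto
    ultimately have "m * g / 2 \<in> R ` {a..b}"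
      using connectedD_interval by blast
    then show False using R_mg pos by fastforce
  qed
  then show ?thesis using rest \<open>t \<in> {a..b}\<close> by blast
qed

end

subsection \<open>Asymptotics of the gliding top\<close>

lemma tendsto_one_of_two_points:
  fixes y :: "real \<Rightarrow> 'a::metric_space"
  assumes cont: "continuous_on {T0..} y"
    and near: "\<And>e. e > 0 \<Longrightarrow> eventually (\<lambda>t. y t \<in> ball P e \<union> ball Q e) at_top"
  shows "(y \<longlongrightarrow> P) at_top \<or> (y \<longlongrightarrow> Q) at_top"
proof (cases "P = Q")
  case True
  then show ?thesis using near by (auto simp: tendsto_iff dist_commute)
next
  case False
  define d where "d = dist P Q / 2"
  have "d > 0" using False by (simp add: d_def)
  have disj: "ball P d \<inter> ball Q d = {}"
    by (rule disjoint_ballI) (simp add: d_def)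
  have *: "(y \<longlongrightarrow> P) at_top"
    if "eventually (\<lambda>t. y t \<in> ball P d) at_top" "ball P d \<inter> ball Q d = {}"
      \<comment> \<open>The claim is stated for arbitrary P and Q because it is applied again with
        the two points exchanged.\<close>
      and near: "\<And>e. e > 0 \<Longrightarrow> eventually (\<lambda>t. y t \<in> ball P e \<union> ball Q e) at_top" for P Q
  proof (rule tendstoI)
    fix e :: real assume "e > 0"
    then have "eventually (\<lambda>t. y t \<in> ball P (min e d) \<union> ball Q (min e d)) at_top"
      using \<open>d > 0\<close> by (intro near) simp
    with that(1) show "eventually (\<lambda>t. dist (y t) P < e) at_top"
      by eventually_elim (use that(2) in \<open>auto simp: dist_commute\<close>)
  qed
  obtain T1 where T1: "\<And>t. t \<ge> T1 \<Longrightarrow> y t \<in> ball P d \<union> ball Q d"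
    using near[OF \<open>d > 0\<close>] by (auto simp: eventually_at_top_linorder)
  define T where "T = max T0 T1"
  have T1': "y t \<in> ball P d \<union> ball Q d" if "t \<ge> T" for t
    using T1 that by (simp add: T_def)
  have "connected (y ` {T..})"
    by (intro connected_continuous_image continuous_on_subset[OF cont]) (auto simp: T_def)
  then have "ball P d \<inter> y ` {T..} = {} \<or> ball Q d \<inter> y ` {T..} = {}"
    by (rule connectedD) (use T1' disj in blast)+
  then have "(\<forall>t\<ge>T. y t \<in> ball P d) \<or> (\<forall>t\<ge>T. y t \<in> ball Q d)"
    using T1' by blast
  then have "eventually (\<lambda>t. y t \<in> ball P d) at_top \<or> eventually (\<lambda>t. y t \<in> ball Q d) at_top"
    by (auto simp: eventually_at_top_linorder)
  then show ?thesis
    using *[of P Q] *[of Q P] disj near by (auto simp: Un_commute Int_commute)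
qed

context gliding_top
begin

text \<open>Although the friction coefficient may be unbounded on bounded sets, the friction force is not
  like dry friction: shift the velocity by a small amount \<open>\<delta>\<close> across \<open>v_A\<close>.  Friction being
  antiparallel to the sliding velocity, a Lipschitz force cannot follow the direction of \<open>v_A\<close>
  unless it is small with \<open>v_A\<close>.\<close>

lemma friction_le_sliding_velocity:
  assumes dom: "gLT_domain m g l I1 \<mu> D" and "B \<subseteq> D" "bounded B"
  obtains C where "C \<ge> 0" "\<And>y. y \<in> B \<Longrightarrow> norm (friction m g l I1 \<mu> y) \<le> C * norm (v_A l I1 y)"
proof -
  obtain r where r: "\<And>y. y \<in> B \<Longrightarrow> norm y \<le> r"
    using \<open>bounded B\<close> bounded_iff by blast
  \<comment> \<open>Enlarged by 1 to contain the shifted states.\<close>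
  define B' where "B' = D \<inter> ball 0 (r + 1)"
  have "bounded B'" "B' \<subseteq> D"
    by (auto simp: B'_def bounded_Int)
  then obtain C where C: "C-lipschitz_on B' (gLT_field m g l I1 \<mu>)"
    using dom unfolding gLT_domain_def by blast
  have C0: "C \<ge> 0" using C by (rule lipschitz_on_nonneg)
  have lip: "norm (friction m g l I1 \<mu> x - friction m g l I1 \<mu> y) \<le> m * C * dist x y"
    if "x \<in> B'" "y \<in> B'" for x y
  proof -
    have "friction m g l I1 \<mu> x - friction m g l I1 \<mu> y
        = lift_hor (m *\<^sub>R (fst (gLT_field m g l I1 \<mu> x) - fst (gLT_field m g l I1 \<mu> y)))"
      by (simp add: friction_eq_field linear_diff[OF linear_lift_hor, symmetric] scaleR_right_diff_distrib)
    then have "norm (friction m g l I1 \<mu> x - friction m g l I1 \<mu> y)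
        = m * dist (fst (gLT_field m g l I1 \<mu> x)) (fst (gLT_field m g l I1 \<mu> y))"
      using pos by (simp add: dist_norm)
    also have "\<dots> \<le> m * dist (gLT_field m g l I1 \<mu> x) (gLT_field m g l I1 \<mu> y)"
      using pos by (intro mult_left_mono dist_fst_le) auto
    also have "\<dots> \<le> m * (C * dist x y)"
      using pos by (intro mult_left_mono lipschitz_onD[OF C that]) auto
    finally show ?thesis by (simp add: mult.assoc)
  qed
  obtain T where T: "open T" "D = phase_space \<inter> T"
    using dom unfolding gLT_domain_def openin_open by blast
  have "norm (friction m g l I1 \<mu> y) \<le> 2 * m * C * norm (v_A l I1 y)" if "y \<in> B" for y
  proof (cases "v_A l I1 y = 0")
    case True
    then show ?thesis by (simp add: friction_def)
  next
    case False
    obtain u L n where y: "y = (u, L, n)" by (cases y)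
    define v where "v = v_A l I1 y"
    \<comment> \<open>The horizontal unit vector orthogonal to \<open>v\<close>.\<close>
    define e :: "real^2" where "e = (1 / norm v) *\<^sub>R vector [- v $ 2, v $ 1]"
    have v0: "norm v > 0" using False by (simp add: v_def)
    have nv: "(norm v)\<^sup>2 = (v $ 1)\<^sup>2 + (v $ 2)\<^sup>2"
      by (simp only: power2_norm_eq_inner inner_vec_def sum_3) (simp add: v_def power2_eq_square)
    have ev: "lift_hor e \<bullet> v = 0"
      by (simp add: e_def inner_vec_def sum_3)
    have ne: "norm e = 1"
    proof -
      have "(norm e)\<^sup>2 = ((v $ 1)\<^sup>2 + (v $ 2)\<^sup>2) / (norm v)\<^sup>2"
        unfolding power2_norm_eq_inner[of e]
        by (simp add: e_def inner_vec_def sum_2 power2_eq_square add_divide_distrib)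
      then have "(norm e)\<^sup>2 = 1" using v0 by (simp flip: nv)
      then show ?thesis by (simp add: power2_eq_1_iff) (metis norm_ge_zero not_one_le_zero neg_0_le_iff_le)
    qed
    have "y \<in> T" using T(2) that \<open>B \<subseteq> D\<close> by blast
    then obtain \<epsilon> where \<epsilon>: "\<epsilon> > 0" "ball y \<epsilon> \<subseteq> T" using T(1) open_contains_ball by blast
    \<comment> \<open>The first bound keeps the shifted state in \<open>D\<close>, the second keeps
      it in \<open>B'\<close>, and the bound by \<open>norm v\<close> is what turns the Lipschitz
      estimate into one proportional to the sliding velocity.\<close>
    define \<delta> where "\<delta> = min (\<epsilon> / 2) (min (1 / 2) (norm v))"
    have \<delta>: "\<delta> > 0" "\<delta> < \<epsilon>" "\<delta> < 1" "\<delta> \<le> norm v" using \<epsilon>(1) v0 by (auto simp: \<delta>_def)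
    define y' where "y' = (u + \<delta> *\<^sub>R e, L, n)"
    have dist: "dist y y' = \<delta>"
      using \<delta>(1) by (simp add: y y'_def dist_Pair_Pair ne dist_norm)
    have "y \<in> B'" using that r[OF that] \<open>B \<subseteq> D\<close> by (auto simp: B'_def)
    moreover have "y' \<in> B'"
    proof -
      have "y' \<in> ball y \<epsilon>" using dist \<delta>(2) by simp
      moreover have "y' \<in> phase_space" using T(2) that \<open>B \<subseteq> D\<close> by (auto simp: y y'_def)
      moreover have "norm y' < r + 1"
        using norm_triangle_sub[of y' y] dist r[OF that] \<delta>(3) by (simp add: dist_norm norm_minus_commute)
      ultimately show ?thesis using T(2) \<epsilon>(2) by (auto simp: B'_def)
    qed
    ultimately have le: "norm (friction m g l I1 \<mu> y - friction m g l I1 \<mu> y') \<le> m * C * \<delta>"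
      using lip dist by metis
    define \<kappa> \<kappa>' where "\<kappa> = \<mu> y * g_n m g l I1 \<mu> y" and "\<kappa>' = \<mu> y' * g_n m g l I1 \<mu> y'"
    have v': "v_A l I1 y' = v + \<delta> *\<^sub>R lift_hor e"
      by (simp add: v_def y y'_def v_A_eq linear_add[OF linear_lift_hor] linear_scale[OF linear_lift_hor])
    define x where "x = friction m g l I1 \<mu> y - friction m g l I1 \<mu> y'"
    have x: "x = (\<kappa>' - \<kappa>) *\<^sub>R v + (\<kappa>' * \<delta>) *\<^sub>R lift_hor e"
      by (simp add: x_def friction_def \<kappa>_def[symmetric] \<kappa>'_def[symmetric] v' v_def[symmetric] algebra_simps)
    \<comment> \<open>The component along \<open>e\<close> bounds the coefficient at the shifted
      state, the component along \<open>v\<close> the change of the coefficient; together they give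
      the factor 2.\<close>
    have "x \<bullet> lift_hor e = \<kappa>' * \<delta>"
      using ev ne by (simp add: x inner_add_left inner_commute[of v] flip: power2_norm_eq_inner)
    then have "\<bar>\<kappa>' * \<delta>\<bar> \<le> m * C * \<delta>"
      using Cauchy_Schwarz_ineq2[of x "lift_hor e"] ne le by (simp add: x_def)
    then have 1: "\<bar>\<kappa>'\<bar> \<le> m * C" using \<delta>(1) by (simp add: abs_mult)
    have "x \<bullet> v = (\<kappa>' - \<kappa>) * (norm v)\<^sup>2"
      using ev by (simp add: x inner_add_left power2_norm_eq_inner)
    then have "\<bar>\<kappa>' - \<kappa>\<bar> * (norm v)\<^sup>2 \<le> norm x * norm v"
      using Cauchy_Schwarz_ineq2[of x v] by (simp add: abs_mult)
    also have "\<dots> \<le> m * C * \<delta> * norm v" using le by (simp add: x_def mult_right_mono)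
    also have "\<dots> \<le> m * C * norm v * norm v"
      using \<delta>(4) C0 pos by (intro mult_right_mono mult_left_mono) auto
    finally have 2: "\<bar>\<kappa>' - \<kappa>\<bar> \<le> m * C" using v0 by (simp add: power2_eq_square)
    have "\<bar>\<kappa>\<bar> \<le> 2 * m * C" using 1 2 by simp
    then show ?thesis
      by (simp add: friction_def \<kappa>_def[symmetric] v_def[symmetric] mult_right_mono)
  qed
  then show ?thesis using that[of "2 * m * C"] C0 pos by simp
qed

end

section \<open>Energy decay and bounds along a fixed solution\<close>

locale supported_gliding_top = gliding_top +
  fixes \<mu> :: "state \<Rightarrow> real" and D :: "state set" and y :: "real \<Rightarrow> state"
  assumes domain: "gLT_domain m g l I1 \<mu> D"
    and solution: "gLT_solution m g l I1 \<mu> D y"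
    and support: "\<And>t. t \<ge> 0 \<Longrightarrow> g_n m g l I1 \<mu> (y t) \<ge> 0"
begin

abbreviation "field \<equiv> gLT_field m g l I1 \<mu>"
abbreviation "fric \<equiv> friction m g l I1 \<mu>"

lemma domain_phase_space: "D \<subseteq> phase_space"
  using domain openin_imp_subset unfolding gLT_domain_def by auto

lemma in_domain: "t \<ge> 0 \<Longrightarrow> y t \<in> D"
  using solution by (simp add: gLT_solution_def)

lemma field_eq: "x \<in> D \<Longrightarrow> field x = forced_field (fric x) x"
  using domain domain_phase_space by (intro gLT_field_eq_forced_field) (auto simp: gLT_domain_def)

lemma g_n_eq: "x \<in> D \<Longrightarrow> g_n m g l I1 \<mu> x = reaction (fric x) x"
  using domain domain_phase_space by (intro g_n_eq_reaction) (auto simp: gLT_domain_def)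

lemma friction_coefficient_pos: "x \<in> D \<Longrightarrow> \<mu> x > 0"
  using domain by (simp add: gLT_domain_def)

lemma motion_solution: "motion {0..} (\<lambda>t. fric (y t)) y"
  unfolding motion_def
proof (intro ballI conjI)
  fix t :: real assume "t \<in> {0..}"
  then have t: "t \<ge> 0" by simp
  show "y t \<in> phase_space" using in_domain[OF t] domain_phase_space by blast
  show "(y has_vector_derivative forced_field (fric (y t)) (y t)) (at t within {0..})"
    using solution t by (simp add: gLT_solution_def flip: field_eq[OF in_domain[OF t]])
qed simp

lemma friction_power: "fric x \<bullet> v_A l I1 x = - (\<mu> x * g_n m g l I1 \<mu> x * (norm (v_A l I1 x))\<^sup>2)"
  by (simp add: friction_def power2_norm_eq_inner)

lemma energy_decreasing:
  assumes "0 \<le> s" "s \<le> t"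
  shows "energy (y t) \<le> energy (y s)"
proof (rule DERIV_nonpos_imp_decreasing_open[OF \<open>s \<le> t\<close>])
  have d: "((\<lambda>t. energy (y t)) has_real_derivative fric (y r) \<bullet> v_A l I1 (y r)) (at r within {0..})"
    if "r \<ge> 0" for r
    using energy_has_real_derivative[OF motion_solution] that by simp
  show "continuous_on {s..t} (\<lambda>t. energy (y t))"
    by (rule continuous_on_subset[OF DERIV_continuous_on[OF d]]) (use assms in auto)
  fix r assume "s < r" "r < t"
  then have "at r within {0..} = at r" using assms by (intro at_within_interior) simp
  then have "DERIV (\<lambda>t. energy (y t)) r :> fric (y r) \<bullet> v_A l I1 (y r)"
    using d[of r] assms \<open>s < r\<close> by simp
  moreover have "fric (y r) \<bullet> v_A l I1 (y r) \<le> 0"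
    using support[of r] friction_coefficient_pos[OF in_domain, of r] assms \<open>s < r\<close>
    by (simp add: friction_power)
  ultimately show "\<exists>y'. DERIV (\<lambda>t. energy (y t)) r :> y' \<and> y' \<le> 0" by blast
qed

lemma energy_lower_bound:
  assumes "norm n = 1"
  shows "m / 2 * (norm u)\<^sup>2 + (norm L)\<^sup>2 / (2 * I1) - m * g * l \<le> energy (u, L, n)"
proof -
  have "- 1 \<le> n \<bullet> z_hat"
    using Cauchy_Schwarz_ineq2[of n z_hat] assms norm_z_hat by simp
  then have "m * g * l * (- 1) \<le> m * g * l * (n \<bullet> z_hat)"
    using pos by (intro mult_left_mono) auto
  moreover have "0 \<le> m / 2 * (l / I1 * (cross3 L n \<bullet> z_hat))\<^sup>2" using pos by simp
  ultimately show ?thesis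
    unfolding energy_def case_prod_conv distrib_left by linarith
qed

lemma bounded_solution: "bounded (y ` {0..})"
proof -
  \<comment> \<open>The potential energy is at least \<open>- (m * g * l)\<close>, so this bounds
    the energies of the horizontal motion and of L.\<close>
  define E where "E = energy (y 0) + m * g * l"
  have "y t \<in> cball 0 (sqrt (E * (2 / m))) \<times> cball 0 (sqrt (E * (2 * I1))) \<times> cball 0 1"
    if "t \<ge> 0" for t
  proof -
    obtain u L n where y: "y t = (u, L, n)" by (cases "y t")
    have n: "norm n = 1" using in_domain[OF that] domain_phase_space y by auto
    have "m / 2 * (norm u)\<^sup>2 + (norm L)\<^sup>2 / (2 * I1) \<le> E"
      using energy_lower_bound[OF n, of u L] energy_decreasing[of 0 t] that
      by (simp add: E_def y)
    moreover have "0 \<le> m / 2 * (norm u)\<^sup>2" "0 \<le> (norm L)\<^sup>2 / (2 * I1)" using pos by auto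
    ultimately have "m / 2 * (norm u)\<^sup>2 \<le> E" "(norm L)\<^sup>2 / (2 * I1) \<le> E" by linarith+
    then have "(norm u)\<^sup>2 \<le> E * (2 / m)" "(norm L)\<^sup>2 \<le> E * (2 * I1)"
      using pos by (simp_all add: field_simps)
    then show ?thesis using n by (simp add: y real_le_rsqrt)
  qed
  then have "y ` {0..} \<subseteq> cball 0 (sqrt (E * (2 / m))) \<times> cball 0 (sqrt (E * (2 * I1))) \<times> cball 0 1"
    by (intro image_subsetI) simp
  then show ?thesis
    by (rule bounded_subset[rotated]) (intro bounded_Times bounded_cball)
qed

text \<open>The field is included for the sake of compactness: its limits supply the derivative of
  the limit motion, also where that motion is outside of \<open>D\<close>.\<close>

lemma solution_lipschitz:
  obtains K where "K \<ge> 0" "\<And>t. t \<ge> 0 \<Longrightarrow> norm (y t, field (y t)) \<le> K"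
    "\<And>s t. s \<ge> 0 \<Longrightarrow> t \<ge> 0 \<Longrightarrow> norm ((y s, field (y s)) - (y t, field (y t))) \<le> K * \<bar>s - t\<bar>"
proof -
  have "y ` {0..} \<subseteq> D" using in_domain by auto
  then obtain C where C: "C-lipschitz_on (y ` {0..}) field"
    using domain bounded_solution unfolding gLT_domain_def by blast
  have "bounded (field ` y ` {0..})"
    using lipschitz_on_uniformly_continuous[OF C] bounded_solution
    by (rule bounded_uniformly_continuous_image)
  then obtain M where M: "M \<ge> 0" "\<And>t. t \<ge> 0 \<Longrightarrow> norm (field (y t)) \<le> M"
    using bounded_pos by (metis (no_types, lifting) atLeast_iff imageI less_imp_le)
  obtain M' where M': "\<And>t. t \<ge> 0 \<Longrightarrow> norm (y t) \<le> M'"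
    using bounded_solution unfolding bounded_iff by auto
  have M'0: "M' \<ge> 0" using M'[of 0] norm_ge_zero order.trans by blast
  have C0: "C \<ge> 0" using C by (rule lipschitz_on_nonneg)
  have d: "norm (y s - y t) \<le> M * norm (s - t)" if "s \<ge> 0" "t \<ge> 0" for s t
  proof (rule differentiable_bound[of "{0..}" y "\<lambda>t h. h *\<^sub>R field (y t)"])
    fix r :: real assume "r \<in> {0..}"
    then show "(y has_derivative (\<lambda>h. h *\<^sub>R field (y r))) (at r within {0..})"
      using solution by (simp add: gLT_solution_def has_vector_derivative_def)
    show "onorm (\<lambda>h. h *\<^sub>R field (y r)) \<le> M"
      using M(2)[of r] \<open>r \<in> {0..}\<close> by (intro onorm_le) (subst norm_scaleR, subst mult.commute, auto intro: mult_right_mono)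
  qed (use that in auto)
  have L: "norm ((y s, field (y s)) - (y t, field (y t))) \<le> (M + C * M) * \<bar>s - t\<bar>" if "s \<ge> 0" "t \<ge> 0" for s t
  proof -
    have "norm ((y s, field (y s)) - (y t, field (y t))) \<le> norm (y s - y t) + norm (field (y s) - field (y t))"
      by (simp add: norm_Pair_le)
    also have "norm (field (y s) - field (y t)) \<le> C * norm (y s - y t)"
      using lipschitz_onD[OF C, of "y s" "y t"] that by (simp add: dist_norm)
    also have "norm (y s - y t) + C * norm (y s - y t) \<le> M * \<bar>s - t\<bar> + C * (M * \<bar>s - t\<bar>)"
      using d[OF that] C0 by (intro add_mono mult_left_mono) auto
    finally show ?thesis by (simp add: algebra_simps)
  qed
  define K where "K = M' + M + (M + C * M)"
  have K: "M' + M \<le> K" "M + C * M \<le> K" "0 \<le> K"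
    using M(1) M'0 C0 by (auto simp: K_def)
  have "norm (y t, field (y t)) \<le> K" if "t \<ge> 0" for t
    using norm_Pair_le[of "y t" "field (y t)"] M(2)[OF that] M'[OF that] K(1) by linarith
  moreover have "norm ((y s, field (y s)) - (y t, field (y t))) \<le> K * \<bar>s - t\<bar>"
    if "s \<ge> 0" "t \<ge> 0" for s t
    using L[OF that] mult_right_mono[OF K(2) abs_ge_zero[of "s - t"]] by linarith
  ultimately show ?thesis using that K(3) by blast
qed

lemma energy_converges:
  obtains E where "((\<lambda>t. energy (y t)) \<longlongrightarrow> E) at_top"
proof -
  let ?S = "(\<lambda>t. energy (y t)) ` {0..}"
  have "- (m * g * l) \<le> energy (y t)" if t: "t \<ge> 0" for t
  proof -
    obtain u L n where y: "y t = (u, L, n)" by (cases "y t")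
    have n: "norm n = 1" using in_domain[OF t] domain_phase_space y by auto
    have "0 \<le> m / 2 * (norm u)\<^sup>2" "0 \<le> (norm L)\<^sup>2 / (2 * I1)" using pos by auto
    with energy_lower_bound[OF n, of u L] show ?thesis unfolding y by linarith
  qed
  then have bdd: "bdd_below ?S" by (intro bdd_belowI[of _ "- (m * g * l)"]) auto
  have "((\<lambda>t. energy (y t)) \<longlongrightarrow> Inf ?S) at_top"
  proof (rule tendstoI)
    fix e :: real assume "e > 0"
    then obtain t0 where t0: "t0 \<ge> 0" "energy (y t0) < Inf ?S + e"
      using cInf_lessD[of ?S "Inf ?S + e"] by auto
    have "dist (energy (y t)) (Inf ?S) < e" if t: "t \<ge> t0" for t
    proof -
      have "Inf ?S \<le> energy (y t)" using t t0(1) by (intro cInf_lower bdd) auto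
      moreover have "energy (y t) < Inf ?S + e" using energy_decreasing[OF t0(1) t] t0(2) by simp
      ultimately show ?thesis by (simp add: dist_real_def)
    qed
    then show "eventually (\<lambda>t. dist (energy (y t)) (Inf ?S) < e) at_top"
      by (auto simp: eventually_at_top_linorder)
  qed
  then show ?thesis by (rule that)
qed

section \<open>Limit motions of time shifts\<close>

lemma shifts_converge:
  fixes \<tau> :: "nat \<Rightarrow> real"
  assumes \<tau>: "\<And>k. \<tau> k \<ge> 0"
  obtains r Y G where "strict_mono (r :: nat \<Rightarrow> nat)"
    "\<And>s. s \<in> {0..1} \<Longrightarrow> (\<lambda>k. y (\<tau> (r k) + s)) \<longlonglongrightarrow> Y s"
    "\<And>s. s \<in> {0..1} \<Longrightarrow> (\<lambda>k. field (y (\<tau> (r k) + s))) \<longlonglongrightarrow> G s"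
    "\<And>s. s \<in> {0..1} \<Longrightarrow> (Y has_vector_derivative G s) (at s within {0..1})"
proof -
  obtain K where K: "K \<ge> 0" "\<And>t. t \<ge> 0 \<Longrightarrow> norm (y t, field (y t)) \<le> K"
    "\<And>s t. s \<ge> 0 \<Longrightarrow> t \<ge> 0 \<Longrightarrow> norm ((y s, field (y s)) - (y t, field (y t))) \<le> K * \<bar>s - t\<bar>"
    using solution_lipschitz by blast
  define f where "f k s = (y (\<tau> k + s), field (y (\<tau> k + s)))" for k s
  have bound: "norm (f k s) \<le> K" if "s \<in> {0..1}" for k s
    using K(2)[of "\<tau> k + s"] \<tau>[of k] that by (simp add: f_def)
  have lip: "norm (f k s - f k t) \<le> K * \<bar>s - t\<bar>" if "s \<in> {0..1}" "t \<in> {0..1}" for k s t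
    using K(3)[of "\<tau> k + s" "\<tau> k + t"] \<tau>[of k] that by (simp add: f_def)
  have equi: "\<exists>d. 0 < d \<and> (\<forall>k t. t \<in> {0..1} \<and> norm (s - t) < d \<longrightarrow> norm (f k s - f k t) < e)"
    if s: "s \<in> {0..1}" and "0 < e" for s e
  proof (intro exI conjI allI impI)
    \<comment> \<open>\<open>K + 1\<close> because K may be 0.\<close>
    show "0 < e / (K + 1)" using \<open>0 < e\<close> K(1) by simp
    fix k t assume t: "t \<in> {0..1} \<and> norm (s - t) < e / (K + 1)"
    have "norm (f k s - f k t) \<le> K * \<bar>s - t\<bar>" using lip s t by blast
    also have "\<dots> \<le> (K + 1) * \<bar>s - t\<bar>" by (simp add: mult_right_mono)
    also have "\<dots> < e" using t K(1) by (simp add: pos_less_divide_eq mult.commute)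
    finally show "norm (f k s - f k t) < e" .
  qed
  obtain h r where r: "strict_mono (r :: nat \<Rightarrow> nat)"
    and unif: "\<And>e. 0 < e \<Longrightarrow> \<exists>N. \<forall>k s. k \<ge> N \<and> s \<in> {0..1} \<longrightarrow> norm (f (r k) s - h s) < e"
    using Arzela_Ascoli[of "{0..1::real}" f K, OF compact_Icc bound equi] by metis
  define Y G where "Y s = fst (h s)" and "G s = snd (h s)" for s
  have lim: "(\<lambda>k. f (r k) s) \<longlonglongrightarrow> h s" if "s \<in> {0..1}" for s
    unfolding lim_sequentially dist_norm using unif that by meson
  have limY: "(\<lambda>k. y (\<tau> (r k) + s)) \<longlonglongrightarrow> Y s" if "s \<in> {0..1}" for s
    using tendsto_fst[OF lim[OF that]] by (simp add: f_def Y_def)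
  have limG: "(\<lambda>k. field (y (\<tau> (r k) + s))) \<longlonglongrightarrow> G s" if "s \<in> {0..1}" for s
    using tendsto_snd[OF lim[OF that]] by (simp add: f_def G_def)
  \<comment> \<open>Uniform convergence of the derivatives permits differentiating the
    limit.\<close>
  have "\<exists>X. \<forall>s\<in>{0..1}. (\<lambda>k. y (\<tau> (r k) + s)) \<longlonglongrightarrow> X s
      \<and> (X has_derivative (\<lambda>x. x *\<^sub>R G s)) (at s within {0..1})"
  proof (rule has_derivative_sequence[of "{0..1}" _ "\<lambda>k s x. x *\<^sub>R field (y (\<tau> (r k) + s))"])
    show "(\<lambda>k. y (\<tau> (r k) + 0)) \<longlonglongrightarrow> Y 0" by (rule limY) simp
    show "((\<lambda>s. y (\<tau> (r k) + s)) has_derivative (\<lambda>x. x *\<^sub>R field (y (\<tau> (r k) + s)))) (at s within {0..1})"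
      if "s \<in> {0..1}" for k s
    proof -
      have "0 \<le> \<tau> (r k) + s" using \<tau>[of "r k"] that by simp
      then have "(y has_vector_derivative field (y (\<tau> (r k) + s))) (at (\<tau> (r k) + s) within {0..})"
        using solution unfolding gLT_solution_def by blast
      moreover have "(\<lambda>s. \<tau> (r k) + s) ` {0..1} \<subseteq> {0..}" using \<tau>[of "r k"] by auto
      ultimately have "(y has_vector_derivative field (y (\<tau> (r k) + s)))
          (at (\<tau> (r k) + s) within (\<lambda>s. \<tau> (r k) + s) ` {0..1})"
        by (rule has_vector_derivative_within_subset)
      moreover have "((\<lambda>s. \<tau> (r k) + s) has_vector_derivative 1) (at s within {0..1})"
        by (auto intro!: derivative_eq_intros)
      ultimately have "((y \<circ> (\<lambda>s. \<tau> (r k) + s)) has_vector_derivative 1 *\<^sub>R field (y (\<tau> (r k) + s)))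
          (at s within {0..1})"
        by (intro vector_diff_chain_within) auto
      then show ?thesis by (simp add: has_vector_derivative_def o_def)
    qed
    show "\<forall>\<^sub>F k in sequentially. \<forall>s\<in>{0..1}. \<forall>x. norm (x *\<^sub>R field (y (\<tau> (r k) + s)) - x *\<^sub>R G s) \<le> e * norm x"
      if "e > 0" for e :: real
    proof -
      obtain N where N: "\<And>k s. k \<ge> N \<Longrightarrow> s \<in> {0..1} \<Longrightarrow> norm (f (r k) s - h s) < e"
        using unif[OF \<open>e > 0\<close>] by blast
      have "norm (x *\<^sub>R field (y (\<tau> (r k) + s)) - x *\<^sub>R G s) \<le> e * norm x"
        if "k \<ge> N" "s \<in> {0..1}" for k s x
      proof -
        have "norm (field (y (\<tau> (r k) + s)) - G s) \<le> norm (f (r k) s - h s)"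
          using norm_snd_le[of "snd (f (r k) s - h s)" "fst (f (r k) s - h s)"]
          by (cases "h s") (simp add: f_def G_def)
        also have "\<dots> \<le> e" using N[OF that] by simp
        finally show ?thesis
          by (simp add: mult.commute[of e] mult_left_mono flip: scaleR_right_diff_distrib)
      qed
      then show ?thesis unfolding eventually_sequentially by blast
    qed
  qed auto
  then obtain X where X: "\<And>s. s \<in> {0..1} \<Longrightarrow> (\<lambda>k. y (\<tau> (r k) + s)) \<longlonglongrightarrow> X s"
    "\<And>s. s \<in> {0..1} \<Longrightarrow> (X has_vector_derivative G s) (at s within {0..1})"
    unfolding has_vector_derivative_def by blast
  show ?thesis by (rule that[OF r X(1) limG X(2)])
qed

text \<open>Friction is collinear with the sliding velocity, so the absolute value of its power is
  the product of the two norms, and one factor is dominated by the other. In this form the bound can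
  be passed to the limit without any control of \<open>\<mu>\<close>.\<close>

lemma friction_power_bound:
  obtains C where "\<And>t. t \<ge> 0 \<Longrightarrow> (norm (fric (y t)))\<^sup>2 \<le> C * \<bar>fric (y t) \<bullet> v_A l I1 (y t)\<bar>"
proof -
  have "y ` {0..} \<subseteq> D" using in_domain by auto
  then obtain C where C: "\<And>x. x \<in> y ` {0..} \<Longrightarrow> norm (fric x) \<le> C * norm (v_A l I1 x)"
    using friction_le_sliding_velocity[OF domain _ bounded_solution] by metis
  have "(norm (fric (y t)))\<^sup>2 \<le> C * \<bar>fric (y t) \<bullet> v_A l I1 (y t)\<bar>" if "t \<ge> 0" for t
  proof -
    have F: "norm (fric (y t)) = \<bar>\<mu> (y t) * g_n m g l I1 \<mu> (y t)\<bar> * norm (v_A l I1 (y t))"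
      by (simp add: friction_def)
    have "(norm (fric (y t)))\<^sup>2 \<le> norm (fric (y t)) * (C * norm (v_A l I1 (y t)))"
      unfolding power2_eq_square using C that by (intro mult_left_mono) auto
    also have "\<dots> = C * \<bar>fric (y t) \<bullet> v_A l I1 (y t)\<bar>"
      by (simp add: F friction_power abs_mult power2_eq_square)
    finally show ?thesis .
  qed
  then show ?thesis using that by blast
qed

text \<open>At limit points outside of \<open>D\<close> this rests on the lower bound for the friction coefficient there.\<close>

lemma no_sliding_at_limit_point:
  assumes x: "\<And>k. x k \<in> y ` {0..}" and lim: "x \<longlonglongrightarrow> p" and fric: "(\<lambda>k. fric (x k)) \<longlonglongrightarrow> 0"
  shows "reaction 0 p = 0 \<or> v_A l I1 p = 0"
proof -
  have xD: "x k \<in> D" for k using x[of k] in_domain by auto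
  have ph: "p \<in> phase_space"
    using closed_sequentially[OF closed_phase_space _ lim] xD domain_phase_space by blast
  show ?thesis
  proof (cases "p \<in> D")
    case True
    \<comment> \<open>Adding the limit point leaves a bounded subset of \<open>D\<close>, so the
      field is continuous at \<open>p\<close> along the solution.\<close>
    have "insert p (y ` {0..}) \<subseteq> D" "bounded (insert p (y ` {0..}))"
      using True in_domain bounded_solution by auto
    then obtain C where "C-lipschitz_on (insert p (y ` {0..})) field"
      using domain unfolding gLT_domain_def by blast
    then have "continuous_on (insert p (y ` {0..})) field"
      by (rule lipschitz_on_continuous_on)
    then have "(\<lambda>k. field (x k)) \<longlonglongrightarrow> field p"
      using lim x by (intro continuous_on_tendsto_compose[of _ field]) auto
    then have "(\<lambda>k. fric (x k)) \<longlonglongrightarrow> fric p"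
      unfolding friction_eq_field by (intro tendsto_intros)
    then have "fric p = 0" by (rule LIMSEQ_unique[OF _ fric])
    then have "\<mu> p * g_n m g l I1 \<mu> p = 0 \<or> v_A l I1 p = 0"
      by (simp add: friction_def)
    moreover have "g_n m g l I1 \<mu> p = reaction 0 p"
      unfolding g_n_eq[OF True] \<open>fric p = 0\<close> ..
    ultimately show ?thesis
      using friction_coefficient_pos[OF True] by auto
  next
    case False
    have "p \<in> closure D" using xD lim closure_sequential by blast
    with False have "p \<in> closure D - D" by blast
    moreover have "\<forall>p\<in>closure D - D. \<exists>c>0. \<exists>\<epsilon>>0. \<forall>y\<in>D \<inter> ball p \<epsilon>. \<mu> y \<ge> c"
      using domain unfolding gLT_domain_def by (elim conjE)
    ultimately obtain c \<epsilon> where c: "c > 0" "\<epsilon> > 0" "\<And>z. z \<in> D \<inter> ball p \<epsilon> \<Longrightarrow> \<mu> z \<ge> c"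
      by meson
    have "eventually (\<lambda>k. x k \<in> ball p \<epsilon>) sequentially"
      using lim c(2) by (simp add: tendsto_iff dist_commute)
    \<comment> \<open>Both sides have limits although \<open>p\<close> is outside of
      \<open>D\<close>: the left side contains only \<open>reaction\<close> and \<open>v_A\<close>,
      which are continuous on \<open>phase_space\<close>.\<close>
    then have ev: "eventually (\<lambda>k. c * (\<bar>reaction (fric (x k)) (x k)\<bar> * norm (v_A l I1 (x k))) \<le> norm (fric (x k))) sequentially"
    proof eventually_elim
      case (elim k)
      then have "c \<le> \<mu> (x k)" using c(3) xD by simp
      then have "c * (\<bar>g_n m g l I1 \<mu> (x k)\<bar> * norm (v_A l I1 (x k)))
          \<le> \<mu> (x k) * (\<bar>g_n m g l I1 \<mu> (x k)\<bar> * norm (v_A l I1 (x k)))"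
        by (intro mult_right_mono) auto
      also have "\<dots> = norm (fric (x k))"
        using friction_coefficient_pos[OF xD, of k] by (simp add: friction_def abs_mult mult.assoc)
      finally show ?case
        unfolding g_n_eq[OF xD] .
    qed
    have "(\<lambda>k. c * (\<bar>reaction (fric (x k)) (x k)\<bar> * norm (v_A l I1 (x k))))
        \<longlonglongrightarrow> c * (\<bar>reaction 0 p\<bar> * norm (v_A l I1 p))"
      by (intro tendsto_intros fric lim ph)
    from tendsto_le[OF sequentially_bot tendsto_norm[OF fric] this ev]
    have "c * (\<bar>reaction 0 p\<bar> * norm (v_A l I1 p)) \<le> 0" by simp
    then have "\<bar>reaction 0 p\<bar> * norm (v_A l I1 p) \<le> 0" using c(1) by (simp add: mult_le_0_iff)
    then show ?thesis by (auto simp: mult_le_0_iff)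
  qed
qed

lemma limit_point_at_rest:
  assumes \<tau>: "\<And>k. \<tau> k \<ge> 0" "filterlim \<tau> at_top sequentially"
  obtains r p where "strict_mono (r :: nat \<Rightarrow> nat)" "(\<lambda>k. y (\<tau> (r k))) \<longlonglongrightarrow> p"
    "p \<in> rest_states (spin (y 0))"
proof -
  obtain r Y G where r: "strict_mono (r :: nat \<Rightarrow> nat)"
    and limY: "\<And>s. s \<in> {0..1} \<Longrightarrow> (\<lambda>k. y (\<tau> (r k) + s)) \<longlonglongrightarrow> Y s"
    and limG: "\<And>s. s \<in> {0..1} \<Longrightarrow> (\<lambda>k. field (y (\<tau> (r k) + s))) \<longlonglongrightarrow> G s"
    and der: "\<And>s. s \<in> {0..1} \<Longrightarrow> (Y has_vector_derivative G s) (at s within {0..1})"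
    by (rule shifts_converge[where \<tau> = \<tau>, OF \<tau>(1)]) blast
  define \<Phi> where "\<Phi> s = lift_hor (m *\<^sub>R fst (G s))" for s
  have ge0: "\<tau> (r k) + s \<ge> 0" if "s \<in> {0..1}" for k s using \<tau>(1)[of "r k"] that by simp
  have limF: "(\<lambda>k. fric (y (\<tau> (r k) + s))) \<longlonglongrightarrow> \<Phi> s" if "s \<in> {0..1}" for s
    unfolding friction_eq_field \<Phi>_def by (intro tendsto_intros limG that)
  have ph: "Y s \<in> phase_space" if "s \<in> {0..1}" for s
    using closed_sequentially[OF closed_phase_space _ limY[OF that]]
      in_domain[OF ge0[OF that]] domain_phase_space by blast
  have "G s = forced_field (\<Phi> s) (Y s)" if "s \<in> {0..1}" for s
  proof (rule LIMSEQ_unique[OF limG[OF that]])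
    show "(\<lambda>k. field (y (\<tau> (r k) + s))) \<longlonglongrightarrow> forced_field (\<Phi> s) (Y s)"
      using tendsto_forced_field[OF limF[OF that] limY[OF that] ph[OF that]]
      by (simp add: field_eq in_domain ge0[OF that])
  qed
  then have mot: "motion {0..1} \<Phi> Y"
    using der ph by (simp add: motion_def \<Phi>_def)
  have unbounded: "filterlim (\<lambda>k. \<tau> (r k) + s) at_top sequentially" for s
    using filterlim_tendsto_add_at_top[OF tendsto_const[of s]
        filterlim_compose[OF \<tau>(2) filterlim_subseq[OF r]]]
    by (simp add: add.commute)
  obtain E where E: "((\<lambda>t. energy (y t)) \<longlongrightarrow> E) at_top" using energy_converges .
  \<comment> \<open>All shifted times tend to infinity, so each state of the limit motion has the
    limiting energy.\<close>
  have energy: "energy (Y s) = E" if "s \<in> {0..1}" for s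
    using LIMSEQ_unique[OF tendsto_energy[OF limY[OF that]] filterlim_compose[OF E unbounded]] .
  have power0: "\<Phi> s \<bullet> v_A l I1 (Y s) = 0" if "s \<in> {0..1}" for s
    using has_vector_derivative_constant_on[of 0 1 s "\<lambda>t. energy (Y t)" E, OF _ that energy]
      energy_has_real_derivative[OF mot that]
    by (simp add: has_real_derivative_iff_has_vector_derivative)
  obtain C where C: "\<And>t. t \<ge> 0 \<Longrightarrow> (norm (fric (y t)))\<^sup>2 \<le> C * \<bar>fric (y t) \<bullet> v_A l I1 (y t)\<bar>"
    by (rule friction_power_bound) blast
  have \<Phi>0: "\<Phi> s = 0" if s: "s \<in> {0..1}" for s
  proof -
    have "(\<lambda>k. (norm (fric (y (\<tau> (r k) + s))))\<^sup>2) \<longlonglongrightarrow> (norm (\<Phi> s))\<^sup>2"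
      by (intro tendsto_intros limF s)
    moreover have "(\<lambda>k. C * \<bar>fric (y (\<tau> (r k) + s)) \<bullet> v_A l I1 (y (\<tau> (r k) + s))\<bar>)
        \<longlonglongrightarrow> C * \<bar>\<Phi> s \<bullet> v_A l I1 (Y s)\<bar>"
      by (intro tendsto_intros limF limY s)
    ultimately have "(norm (\<Phi> s))\<^sup>2 \<le> C * \<bar>\<Phi> s \<bullet> v_A l I1 (Y s)\<bar>"
      by (rule LIMSEQ_le) (use C ge0[OF s] in blast)
    then show ?thesis by (simp add: power0[OF s])
  qed
  have "motion {0..1} (\<lambda>_. 0) Y" using mot \<Phi>0 by (simp add: motion_def)
  moreover have "reaction 0 (Y s) = 0 \<or> v_A l I1 (Y s) = 0" if s: "s \<in> {0..1}" for s
    using no_sliding_at_limit_point[OF _ limY[OF s]] limF[OF s] ge0[OF s] by (simp add: \<Phi>0[OF s])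
  ultimately have "Y 0 \<in> rest_states (spin (Y 0))"
    using frictionless_motion_at_rest[of 0 1 Y 0] by simp
  moreover have lim0: "(\<lambda>k. y (\<tau> (r k))) \<longlonglongrightarrow> Y 0" using limY[of 0] by simp
  moreover have "spin (Y 0) = spin (y 0)"
  proof (rule LIMSEQ_unique[OF tendsto_spin[OF lim0]])
    have "spin (y (\<tau> (r k))) = spin (y 0)" for k
      using spin_constant[OF motion_solution, of "\<tau> (r k)" 0] \<tau>(1) by simp
    then show "(\<lambda>k. spin (y (\<tau> (r k)))) \<longlonglongrightarrow> spin (y 0)" by simp
  qed
  ultimately show ?thesis using that[OF r lim0] by simp
qed

section \<open>Convergence to one vertical state\<close>

lemma converges_to_rest_state:
  defines "c \<equiv> spin (y 0)"
  shows "(y \<longlongrightarrow> y_upright 1 c) at_top \<or> (y \<longlongrightarrow> y_upside_down 1 c) at_top"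
proof (rule tendsto_one_of_two_points[of 0])
  show "continuous_on {0..} y"
    using solution unfolding gLT_solution_def by (intro continuous_on_vector_derivative) auto
  fix e :: real assume "e > 0"
  show "eventually (\<lambda>t. y t \<in> ball (y_upright 1 c) e \<union> ball (y_upside_down 1 c) e) at_top"
  proof (rule ccontr)
    let ?U = "ball (y_upright 1 c) e \<union> ball (y_upside_down 1 c) e"
    assume "\<not> ?thesis"
    \<comment> \<open>Otherwise some sequence of times tending to infinity avoids both balls, and so
      does every limit point of the solution along it.\<close>
    then have "\<exists>t. t \<ge> real k \<and> y t \<notin> ?U" for k
      unfolding eventually_at_top_linorder by metis
    then obtain \<tau> where \<tau>: "\<And>k. \<tau> k \<ge> real k" "\<And>k. y (\<tau> k) \<notin> ?U" by metis
    have "\<tau> k \<ge> 0" for k using \<tau>(1)[of k] by (meson of_nat_0_le_iff order.trans)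
    moreover have "filterlim \<tau> at_top sequentially"
      by (rule filterlim_at_top_mono[OF filterlim_real_sequentially]) (simp add: \<tau>(1))
    ultimately obtain r p where "strict_mono (r :: nat \<Rightarrow> nat)" and lim: "(\<lambda>k. y (\<tau> (r k))) \<longlonglongrightarrow> p"
      and "p \<in> rest_states c"
      unfolding c_def by (rule limit_point_at_rest) blast
    then have "p \<in> ?U" using \<open>e > 0\<close> by (auto simp: rest_states_def)
    then have "eventually (\<lambda>k. y (\<tau> (r k)) \<in> ?U) sequentially"
      using lim by (intro topological_tendstoD[of _ p]) auto
    then show False using \<tau>(2) by simp
  qed
qed

end

theorem proposition3p1:
  fixes m g l I1 I3 :: real
    and \<mu> :: "state \<Rightarrow> real"
    and D :: "state set"
    and y :: "real \<Rightarrow> state"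
  assumes "m > 0" "g > 0" "l > 0" "I1 > 0" "I3 > 0"
    and "gLT_domain m g l I1 \<mu> D"
    and "gLT_solution m g l I1 \<mu> D y"
    and "\<forall>t\<ge>0. g_n m g l I1 \<mu> (y t) \<ge> 0"
  defines "w3 \<equiv> omega3 I1 I3 (y 0)"
  shows "((y \<longlongrightarrow> y_upright I3 w3) at_top \<or> (y \<longlongrightarrow> y_upside_down I3 w3) at_top) \<and>
         \<not> ((y \<longlongrightarrow> y_upright I3 w3) at_top \<and> (y \<longlongrightarrow> y_upside_down I3 w3) at_top)"
proof -
  interpret supported_gliding_top m g l I1 \<mu> D y
    using assms by unfold_locales auto
  have "norm (snd (snd (y 0))) = 1"
    using in_domain[of 0] domain_phase_space by (cases "y 0") auto
  \<comment> \<open>For a unit axis the two terms of omega . n with 1/I1 cancel and leave (L .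
    n)/I3.\<close>
  then have "I3 * w3 = spin (y 0)"
    using \<open>I1 > 0\<close> \<open>I3 > 0\<close>
    by (cases "y 0") (simp add: w3_def omega3_def omega_def spin_def inner_add_left norm_eq_1 field_simps)
  then have "(y \<longlongrightarrow> y_upright I3 w3) at_top \<or> (y \<longlongrightarrow> y_upside_down I3 w3) at_top"
    using converges_to_rest_state by (simp add: y_upright_def y_upside_down_def)
  \<comment> \<open>The axes differ, so the states are distinct even for zero spin.\<close>
  moreover have "y_upright I3 w3 \<noteq> y_upside_down I3 w3"
  proof
    assume "y_upright I3 w3 = y_upside_down I3 w3"
    then have "z_hat $ 3 = (- z_hat) $ 3" by (simp only: y_upright_def y_upside_down_def prod.inject)
    then show False by simp
  qed
  ultimately show ?thesis
    using tendsto_unique[OF trivial_limit_at_top_linorder] by blast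
qed

end
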